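(* In the second-price-auction speculation game, speculation results in an efficiency loss in the form of private value destruction. Sellers are better off in the presence of the speculator, while the auctioneer is worse off.
   Context: Setting. $N\ge2$ risk-neutral sellers each own one item; their private values $v_i$ are drawn independently from a CDF $F$ on $[0,1]$ with a density $f$, and $F(0)=0<F(v)$ for all $v\in(0,1]$. An auctioneer buys one item by a reverse second-price auction with reserve price $r\in(0,1]$: the lowest bid not exceeding $r$ wins, and the winner is paid the minimum of $r$ and the lowest competing bid. A seller who sells (to the auctioneer or to the speculator) at price $t$ gets $t-v_i$, and gets $0$ without a transaction. A risk-neutral speculator has no item and value $0$ for any item. Stage 1: he offers every seller a price $p\in[0,r]$, chosen to maximize his expected profit (auction revenue minus acquisition payments); sellers simultaneously accept or reject. Stage 2: the auction is held among the sellers who rejected and the speculator (if he acquired at least one item). In the auction sellers bid truthfully, and the speculator bids $0$ for one of his items and withholds the others, which are worth $0$ to him ("private value destruction" refers to the loss of the former owners' values for such items). Equilibrium: with $\pi_0=\int_0^r[1-F(x)]^{N-1}dx$, seller $i$ accepts if and only if $v_i<v^*(p)$, where $v^*(p)=0$ for $p\le\pi_0$ and, for $\pi_0<p\le r$, $v^*(p)$ is the unique solution $v$ of $p-v=\int_{v}^r[1-F(x)]^{N-1}dx$. The speculator can always obtain a positive expected profit, so he induces a positive cutoff. The comparison is between this equilibrium outcome and the outcome of the same auction in the absence of the speculator. *)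

theory Defs
  imports "HOL-Probability.Probability"
begin

text \<open>
  A value profile is a function w on seller indices 0, ..., N - 1. The speculator takes part in
  the auction as bidder number N.
\<close>

subsection \<open>Reverse second-price auction with reserve price r, bidder set B and bids b\<close>

definition auction_sale :: "real \<Rightarrow> nat set \<Rightarrow> (nat \<Rightarrow> real) \<Rightarrow> bool" where
  "auction_sale r B b \<longleftrightarrow> (\<exists>i\<in>B. b i \<le> r)"

text \<open>
  Ties go to the smallest index. The rule does not affect payoffs: a bidder winning a tie under
  truthful bidding is paid his own value.
\<close>

definition lowest_bidder :: "nat set \<Rightarrow> (nat \<Rightarrow> real) \<Rightarrow> nat" where
  "lowest_bidder B b = (LEAST i. i \<in> B \<and> (\<forall>j\<in>B. b i \<le> b j))"

definition auction_wins :: "real \<Rightarrow> nat set \<Rightarrow> (nat \<Rightarrow> real) \<Rightarrow> nat \<Rightarrow> bool" where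
  "auction_wins r B b i \<longleftrightarrow> i \<in> B \<and> auction_sale r B b \<and> i = lowest_bidder B b"

text \<open>Without a competing bid the payment is r.\<close>

definition auction_price :: "real \<Rightarrow> nat set \<Rightarrow> (nat \<Rightarrow> real) \<Rightarrow> real" where
  "auction_price r B b = Min (insert r (b ` (B - {lowest_bidder B b})))"

definition bidder_payoff :: "real \<Rightarrow> nat set \<Rightarrow> (nat \<Rightarrow> real) \<Rightarrow> real \<Rightarrow> nat \<Rightarrow> real" where
  "bidder_payoff r B b val i = (if auction_wins r B b i then auction_price r B b - val else 0)"

text \<open>A is the auctioneer's value for an item.\<close>

definition buyer_payoff :: "real \<Rightarrow> real \<Rightarrow> nat set \<Rightarrow> (nat \<Rightarrow> real) \<Rightarrow> real" where
  "buyer_payoff A r B b = (if auction_sale r B b then A - auction_price r B b else 0)"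

subsection \<open>Outcome without the speculator\<close>

definition seller_payoff0 :: "nat \<Rightarrow> real \<Rightarrow> (nat \<Rightarrow> real) \<Rightarrow> nat \<Rightarrow> real" where
  "seller_payoff0 N r w i = bidder_payoff r {..<N} w (w i) i"

definition auctioneer_payoff0 :: "real \<Rightarrow> nat \<Rightarrow> real \<Rightarrow> (nat \<Rightarrow> real) \<Rightarrow> real" where
  "auctioneer_payoff0 A N r w = buyer_payoff A r {..<N} w"

definition surplus0 :: "real \<Rightarrow> nat \<Rightarrow> real \<Rightarrow> (nat \<Rightarrow> real) \<Rightarrow> real" where
  "surplus0 A N r w = (\<Sum>i<N. seller_payoff0 N r w i) + auctioneer_payoff0 A N r w"

subsection \<open>Outcome with the speculator, at offer p and acceptance cutoff c\<close>

definition cutoff :: "(real \<Rightarrow> real) \<Rightarrow> nat \<Rightarrow> real \<Rightarrow> real \<Rightarrow> real" where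
  "cutoff F N r p =
    (if p \<le> integral {0..r} (\<lambda>x. (1 - F x) ^ (N - 1)) then 0
     else (THE c. 0 \<le> c \<and> c \<le> r \<and> p - c = integral {c..r} (\<lambda>x. (1 - F x) ^ (N - 1))))"

definition accepters :: "nat \<Rightarrow> real \<Rightarrow> (nat \<Rightarrow> real) \<Rightarrow> nat set" where
  "accepters N c w = {i. i < N \<and> w i < c}"

definition spec_bidders :: "nat \<Rightarrow> real \<Rightarrow> (nat \<Rightarrow> real) \<Rightarrow> nat set" where
  "spec_bidders N c w =
    ({..<N} - accepters N c w) \<union> (if accepters N c w = {} then {} else {N})"

definition spec_bids :: "nat \<Rightarrow> (nat \<Rightarrow> real) \<Rightarrow> nat \<Rightarrow> real" where
  "spec_bids N w = w(N := 0)"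

definition seller_payoff1 ::
    "nat \<Rightarrow> real \<Rightarrow> real \<Rightarrow> real \<Rightarrow> (nat \<Rightarrow> real) \<Rightarrow> nat \<Rightarrow> real" where
  "seller_payoff1 N r p c w i =
    (if i \<in> accepters N c w then p - w i
     else bidder_payoff r (spec_bidders N c w) (spec_bids N w) (w i) i)"

definition speculator_payoff :: "nat \<Rightarrow> real \<Rightarrow> real \<Rightarrow> real \<Rightarrow> (nat \<Rightarrow> real) \<Rightarrow> real" where
  "speculator_payoff N r p c w =
    bidder_payoff r (spec_bidders N c w) (spec_bids N w) 0 N
      - p * real (card (accepters N c w))"

definition auctioneer_payoff1 :: "real \<Rightarrow> nat \<Rightarrow> real \<Rightarrow> real \<Rightarrow> (nat \<Rightarrow> real) \<Rightarrow> real" where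
  "auctioneer_payoff1 A N r c w = buyer_payoff A r (spec_bidders N c w) (spec_bids N w)"

definition surplus1 ::
    "real \<Rightarrow> nat \<Rightarrow> real \<Rightarrow> real \<Rightarrow> real \<Rightarrow> (nat \<Rightarrow> real) \<Rightarrow> real" where
  "surplus1 A N r p c w =
    (\<Sum>i<N. seller_payoff1 N r p c w i) + speculator_payoff N r p c w
      + auctioneer_payoff1 A N r c w"

text \<open>
  The speculator offers in the auction the item bought from seller s and withholds the others;
  their former owners' values are destroyed.
\<close>

definition destroyed_value :: "nat \<Rightarrow> real \<Rightarrow> nat \<Rightarrow> (nat \<Rightarrow> real) \<Rightarrow> real" where
  "destroyed_value N c s w = (\<Sum>i\<in>accepters N c w - {s}. w i)"

text \<open>
  Extra cost of supplying the auctioneer with the item of seller s rather than with the cheapest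
  acquired item; zero if s is an accepting seller of lowest value.
\<close>

definition misallocation :: "nat \<Rightarrow> real \<Rightarrow> nat \<Rightarrow> (nat \<Rightarrow> real) \<Rightarrow> real" where
  "misallocation N c s w =
    (if accepters N c w = {} then 0 else w s - Min (w ` accepters N c w))"

definition optimal_offer ::
    "'w measure \<Rightarrow> (nat \<Rightarrow> 'w \<Rightarrow> real) \<Rightarrow> (real \<Rightarrow> real) \<Rightarrow> nat \<Rightarrow> real \<Rightarrow> real \<Rightarrow> bool" where
  "optimal_offer M v F N r p \<longleftrightarrow> p \<in> {0..r} \<and>
    (\<forall>q\<in>{0..r}.
      (\<integral>\<omega>. speculator_payoff N r q (cutoff F N r q) (\<lambda>i. v i \<omega>) \<partial>M)
        \<le> (\<integral>\<omega>. speculator_payoff N r p (cutoff F N r p) (\<lambda>i. v i \<omega>) \<partial>M))"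

end

theory Submission
  imports Defs
begin

text \<open>
  Let m be the minimum of r and the values of seller i's competitors. Without the speculator
  seller i earns (m - v)^+ if his value is v. The acceptance condition says that p is the
  expectation of max c m, which by independence does not depend on v. With the speculator the
  payoff of seller i is therefore, in expectation, max c m - v if v < c, and it is unchanged
  for v at least c, since he then does not sell once anybody accepts. The auction price changes
  only if at least two sellers accept, and then from below c to at least c; exactly the values of
  all but one of the acquired items are lost.

  The optimal cutoff is positive because at cutoff c the expected profit is that of a speculator who breaks
  even if he acquires at most one item and otherwise pays only c per item. For small c this is
  positive, as the resale price stays away from 0.
\<close>

subsection \<open>The auction for a given value profile\<close>


text \<open>Inserting \<open>r\<close> keeps the minimum defined for empty \<open>I\<close>, where
  it is the payment without a competing bid. Applied to all bidders but the winner it is the auction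
  price.\<close>

definition capped_min :: "real \<Rightarrow> nat set \<Rightarrow> (nat \<Rightarrow> real) \<Rightarrow> real" where
  "capped_min r I w = Min (insert r (w ` I))"

lemma capped_min_le_cap: "finite I \<Longrightarrow> capped_min r I w \<le> r"
  by (simp add: capped_min_def)

lemma capped_min_le: "finite I \<Longrightarrow> i \<in> I \<Longrightarrow> capped_min r I w \<le> w i"
  by (simp add: capped_min_def)

lemma capped_min_ge_iff: "finite I \<Longrightarrow> x \<le> capped_min r I w \<longleftrightarrow> x \<le> r \<and> (\<forall>i\<in>I. x \<le> w i)"
  by (simp add: capped_min_def)

lemma capped_min_gr_iff: "finite I \<Longrightarrow> x < capped_min r I w \<longleftrightarrow> x < r \<and> (\<forall>i\<in>I. x < w i)"
  by (simp add: capped_min_def)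

lemma capped_min_cong: "(\<And>i. i \<in> I \<Longrightarrow> w i = w' i) \<Longrightarrow> capped_min r I w = capped_min r I w'"
  unfolding capped_min_def by (metis image_cong)

lemma lowest_bidder_props:
  assumes "finite B" "B \<noteq> {}"
  shows lowest_bidder_in: "lowest_bidder B b \<in> B"
    and lowest_bidder_le: "j \<in> B \<Longrightarrow> b (lowest_bidder B b) \<le> b j"
proof -
  obtain k where "k \<in> B" "\<forall>j\<in>B. b k \<le> b j"
    using arg_min_if_finite[OF assms, of b] by (meson leI)
  then have "\<exists>i. i \<in> B \<and> (\<forall>j\<in>B. b i \<le> b j)" by blast
  from LeastI_ex[OF this]
  show "lowest_bidder B b \<in> B" "j \<in> B \<Longrightarrow> b (lowest_bidder B b) \<le> b j"
    by (simp_all add: lowest_bidder_def)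
qed

lemma lowest_bidder_eqI:
  assumes "finite B" "k \<in> B" "\<And>j. j \<in> B \<Longrightarrow> j \<noteq> k \<Longrightarrow> b k < b j"
  shows "lowest_bidder B b = k"
  using lowest_bidder_in[of B b] lowest_bidder_le[of B k b] assms by (metis empty_iff leD)

lemma lowest_bidder_cong:
  assumes "\<And>i. i \<in> B \<Longrightarrow> b i = b' i"
  shows "lowest_bidder B b = lowest_bidder B b'"
  unfolding lowest_bidder_def using assms by (intro arg_cong[of _ _ Least] ext) auto

lemma auction_price_capped_min:
  "auction_price r B b = capped_min r (B - {lowest_bidder B b}) b"
  by (simp add: auction_price_def capped_min_def)

lemma auction_cong:
  assumes "\<And>i. i \<in> B \<Longrightarrow> b i = b' i"
  shows bidder_payoff_cong: "bidder_payoff r B b = bidder_payoff r B b'"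
    and buyer_payoff_cong: "buyer_payoff A r B b = buyer_payoff A r B b'"
proof -
  have low: "lowest_bidder B b = lowest_bidder B b'"
    using assms by (rule lowest_bidder_cong)
  have sale: "auction_sale r B b = auction_sale r B b'"
    using assms by (simp add: auction_sale_def)
  have price: "auction_price r B b = auction_price r B b'"
    unfolding auction_price_capped_min low using assms by (intro capped_min_cong) auto
  show "bidder_payoff r B b = bidder_payoff r B b'"
    unfolding bidder_payoff_def auction_wins_def low sale price ..
  show "buyer_payoff A r B b = buyer_payoff A r B b'"
    unfolding buyer_payoff_def sale price ..
qed

lemma auction_sale_iff_lowest:
  assumes "finite B" "B \<noteq> {}"
  shows "auction_sale r B b \<longleftrightarrow> b (lowest_bidder B b) \<le> r"
  unfolding auction_sale_def using lowest_bidder_props[OF assms] order_trans by blast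

text \<open>The lowest bidder, if he sells, is paid the minimum on the right. For anyone else the
  lowest bid is among the competing ones and at most his own, so the positive part vanishes, ties
  included. If even the lowest bid exceeds \<open>r\<close>, the cap makes it vanish.\<close>

lemma truthful_payoff:
  assumes "finite B" "i \<in> B"
  shows "bidder_payoff r B b (b i) i = max 0 (capped_min r (B - {i}) b - b i)"
proof -
  have ne: "B \<noteq> {}" using assms by auto
  note low = lowest_bidder_in[OF assms(1) ne, of b] lowest_bidder_le[OF assms(1) ne, of _ b]
  show ?thesis
  proof (cases "i = lowest_bidder B b")
    case True
    have "b i \<le> capped_min r (B - {i}) b \<longleftrightarrow> b i \<le> r"
      using assms low True by (auto simp: capped_min_ge_iff)
    then show ?thesis
      using True assms auction_sale_iff_lowest[OF assms(1) ne, of r b]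
      by (auto simp: bidder_payoff_def auction_wins_def auction_price_capped_min)
  next
    case False
    then have "capped_min r (B - {i}) b \<le> b (lowest_bidder B b)"
      using assms low by (intro capped_min_le) auto
    then show ?thesis
      using False low(2)[OF assms(2)] by (auto simp: bidder_payoff_def auction_wins_def)
  qed
qed

text \<open>The price is a transfer from the auctioneer to the winner and cancels; only the lowest
  bidder contributes to the sum.\<close>

lemma auction_surplus:
  assumes "finite B" "B \<noteq> {}"
  shows "(\<Sum>i\<in>B. bidder_payoff r B b (b i) i) + buyer_payoff A r B b
    = (if auction_sale r B b then A - Min (b ` B) else 0)"
proof -
  let ?k = "lowest_bidder B b"
  note low = lowest_bidder_in[OF assms, of b] lowest_bidder_le[OF assms, of _ b]
  have "Min (b ` B) = b ?k"
    using assms low by (intro Min_eqI) auto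
  moreover have "(\<Sum>i\<in>B. bidder_payoff r B b (b i) i)
      = (\<Sum>i\<in>B. if i = ?k then bidder_payoff r B b (b ?k) ?k else 0)"
    by (intro sum.cong) (auto simp: bidder_payoff_def auction_wins_def)
  ultimately show ?thesis
    using assms low by (auto simp: bidder_payoff_def buyer_payoff_def auction_wins_def)
qed

text \<open>Removing the lowest bid raises the minimum the most.\<close>

lemma auction_price_eq_Max:
  assumes "finite B" "B \<noteq> {}"
  shows "auction_price r B b = Max ((\<lambda>i. capped_min r (B - {i}) b) ` B)"
proof -
  let ?k = "lowest_bidder B b"
  note low = lowest_bidder_in[OF assms, of b] lowest_bidder_le[OF assms, of _ b]
  have "capped_min r (B - {i}) b \<le> capped_min r (B - {?k}) b" if "i \<in> B" for i
  proof (cases "i = ?k")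
    case False
    then have "capped_min r (B - {i}) b \<le> b ?k"
      using assms low by (intro capped_min_le) auto
    then show ?thesis
      using assms low capped_min_le_cap[of "B - {i}" r b] by (auto simp: capped_min_ge_iff intro: order_trans)
  qed simp
  then show ?thesis
    unfolding auction_price_capped_min using assms low by (intro Max_eqI[symmetric]) auto
qed

section \<open>Payoffs and surplus without the speculator\<close>

lemma seller_payoff0_eq:
  "i < N \<Longrightarrow> seller_payoff0 N r w i = max 0 (capped_min r ({..<N} - {i}) w - w i)"
  by (simp add: seller_payoff0_def truthful_payoff)

text \<open>The maximum over all sellers avoids the profile-dependent index of the winner, which
  helps both with measurability and in the comparison with the speculator's auction.\<close>

lemma auctioneer_payoff0_eq:
  assumes "0 < N"
  shows "auctioneer_payoff0 A N r w =
    (if \<exists>i<N. w i \<le> r then A - Max ((\<lambda>i. capped_min r ({..<N} - {i}) w) ` {..<N}) else 0)"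
proof -
  have "{..<N} \<noteq> {}" using assms by auto
  from auction_price_eq_Max[OF _ this] show ?thesis
    by (auto simp: auctioneer_payoff0_def buyer_payoff_def auction_sale_def)
qed

lemma surplus0_eq:
  assumes "0 < N"
  shows "surplus0 A N r w = (if \<exists>i<N. w i \<le> r then A - Min (w ` {..<N}) else 0)"
proof -
  have "{..<N} \<noteq> {}" using assms by auto
  from auction_surplus[OF _ this] show ?thesis
    by (auto simp: surplus0_def seller_payoff0_def auctioneer_payoff0_def auction_sale_def)
qed

lemma finite_accepters [simp]: "finite (accepters N c w)"
  by (simp add: accepters_def)

lemma accepters_subset: "accepters N c w \<subseteq> {..<N}"
  by (auto simp: accepters_def)

lemma spec_bidders_no_accepters:
  "accepters N c w = {} \<Longrightarrow> spec_bidders N c w = {..<N}"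
  by (simp add: spec_bidders_def)

lemma spec_bids_seller: "i \<in> {..<N} \<Longrightarrow> spec_bids N w i = w i"
  by (simp add: spec_bids_def)

section \<open>Payoffs and surplus at a fixed positive cutoff\<close>

context
  fixes N :: nat and r c :: real and w :: "nat \<Rightarrow> real"
  assumes c_pos: "0 < c" and c_le: "c \<le> r"
begin

text \<open>Rejecting sellers have values at least c, hence positive, so the speculator's zero bid wins.\<close>

lemma speculator_lowest:
  assumes "accepters N c w \<noteq> {}"
  shows "lowest_bidder (spec_bidders N c w) (spec_bids N w) = N"
    and "auction_sale r (spec_bidders N c w) (spec_bids N w)"
    and "auction_price r (spec_bidders N c w) (spec_bids N w)
      = capped_min r ({..<N} - accepters N c w) w"
proof -
  have mem: "N \<in> spec_bidders N c w" and fin: "finite (spec_bidders N c w)"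
    using assms by (simp_all add: spec_bidders_def)
  show low: "lowest_bidder (spec_bidders N c w) (spec_bids N w) = N"
  proof (rule lowest_bidder_eqI[OF fin mem])
    fix j assume "j \<in> spec_bidders N c w" "j \<noteq> N"
    then have "j < N" "c \<le> w j"
      by (auto simp: spec_bidders_def accepters_def split: if_splits)
    then show "spec_bids N w N < spec_bids N w j"
      using c_pos by (simp add: spec_bids_def)
  qed
  show "auction_sale r (spec_bidders N c w) (spec_bids N w)"
    unfolding auction_sale_def using c_pos c_le
    by (intro bexI[OF _ mem]) (simp add: spec_bids_def)
  have others: "spec_bidders N c w - {N} = {..<N} - accepters N c w"
    using assms by (auto simp: spec_bidders_def)
  show "auction_price r (spec_bidders N c w) (spec_bids N w)
      = capped_min r ({..<N} - accepters N c w) w"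
    unfolding auction_price_capped_min low others
    by (intro capped_min_cong) (simp add: spec_bids_def)
qed

text \<open>A rejecting seller is unaffected. If nobody accepts, the two auctions coincide.
  Otherwise he loses to the zero bid, and without the speculator he would have lost to the accepter,
  whose value is below \<open>c\<close> and hence below his own.\<close>

lemma seller_payoff1_eq:
  assumes "i < N"
  shows "seller_payoff1 N r p c w i = (if w i < c then p - w i else seller_payoff0 N r w i)"
proof (cases "w i < c")
  case True
  then show ?thesis using assms by (simp add: seller_payoff1_def accepters_def)
next
  case False
  then have i: "i \<notin> accepters N c w" by (simp add: accepters_def)
  show ?thesis
  proof (cases "accepters N c w = {}")
    case True
    then show ?thesis
      using False i bidder_payoff_cong[where B = "{..<N}", OF spec_bids_seller]
      by (simp add: seller_payoff1_def seller_payoff0_def spec_bidders_no_accepters)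
  next
    case nonempty: False
    then obtain j where j: "j < N" "w j < c" by (auto simp: accepters_def)
    then have "capped_min r ({..<N} - {i}) w \<le> w j"
      using False by (intro capped_min_le) auto
    then have "seller_payoff0 N r w i = 0"
      using assms j False by (simp add: seller_payoff0_eq)
    then show ?thesis
      using False i assms speculator_lowest(1)[OF nonempty]
      by (simp add: seller_payoff1_def bidder_payoff_def auction_wins_def)
  qed
qed

lemma speculator_payoff_eq:
  "speculator_payoff N r q c w =
    (if accepters N c w = {} then 0 else capped_min r ({..<N} - accepters N c w) w)
      - q * real (card (accepters N c w))"
proof (cases "accepters N c w = {}")
  case True
  then show ?thesis
    by (simp add: speculator_payoff_def bidder_payoff_def auction_wins_def spec_bidders_no_accepters)
next
  case False
  then show ?thesis
    using speculator_lowest[OF False]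
    by (simp add: speculator_payoff_def bidder_payoff_def auction_wins_def spec_bidders_def)
qed

lemma capped_min_rejecters_ge: "c \<le> capped_min r ({..<N} - accepters N c w) w"
  using c_le by (auto simp: capped_min_ge_iff accepters_def)

text \<open>The accepter \<open>i\<close> is still among the competitors of
  \<open>k\<close>.\<close>

lemma capped_min_others_less:
  "i \<in> accepters N c w \<Longrightarrow> i \<noteq> k \<Longrightarrow> capped_min r ({..<N} - {k}) w < c"
  using capped_min_le[of "{..<N} - {k}" i r w] by (auto simp: accepters_def)

text \<open>
  Since an acceptance price of max c m, with m the capped minimum of the other values, makes the
  speculator break even on a single acquisition, his gain comes only from acquiring several items.
\<close>

lemma speculation_gain:
  "(if accepters N c w = {} then 0 else capped_min r ({..<N} - accepters N c w) w)
      - (\<Sum>i\<in>accepters N c w. max c (capped_min r ({..<N} - {i}) w))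
    = (if \<exists>i\<in>accepters N c w. \<exists>j\<in>accepters N c w. i \<noteq> j
       then capped_min r ({..<N} - accepters N c w) w - c * real (card (accepters N c w)) else 0)"
proof (cases "\<exists>i\<in>accepters N c w. \<exists>j\<in>accepters N c w. i \<noteq> j")
  case True
  \<comment> \<open>Whichever \<open>k\<close> is removed, one of two distinct accepters
    remains.\<close>
  then have "max c (capped_min r ({..<N} - {k}) w) = c" for k
    using capped_min_others_less[of _ k] by (metis max.absorb3)
  then show ?thesis using True by auto
next
  case False
  then consider "accepters N c w = {}" | i where "accepters N c w = {i}" by blast
  then show ?thesis
  proof cases
    \<comment> \<open>The competitors of the only accepter are exactly the rejecters, whose capped
      minimum is at least \<open>c\<close>; revenue and cost agree.\<close>
    case (2 i)
    then show ?thesis using capped_min_rejecters_ge by simp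
  qed simp
qed

lemma auctioneer_payoff1_eq:
  "auctioneer_payoff1 A N r c w =
    (if accepters N c w = {} then auctioneer_payoff0 A N r w
     else A - capped_min r ({..<N} - accepters N c w) w)"
proof (cases "accepters N c w = {}")
  case True
  then show ?thesis
    using buyer_payoff_cong[where B = "{..<N}", OF spec_bids_seller]
    by (simp add: auctioneer_payoff1_def auctioneer_payoff0_def spec_bidders_no_accepters)
next
  case False
  then show ?thesis
    using speculator_lowest[OF False] by (simp add: auctioneer_payoff1_def buyer_payoff_def)
qed

text \<open>Acquisition payments and the auction price are transfers and cancel. Every acquired item
  costs its former owner's value, whereas the auctioneer gains \<open>A\<close> only once.\<close>

lemma surplus1_eq:
  "surplus1 A N r p c w =
    (if accepters N c w = {} then surplus0 A N r w else A - (\<Sum>i\<in>accepters N c w. w i))"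
proof (cases "accepters N c w = {}")
  case True
  then have "seller_payoff1 N r p c w i = seller_payoff0 N r w i" if "i < N" for i
    using that by (auto simp: seller_payoff1_eq accepters_def)
  then show ?thesis
    using True
    by (simp add: surplus1_def surplus0_def speculator_payoff_eq auctioneer_payoff1_eq)
next
  case False
  have "seller_payoff1 N r p c w i = 0" if "i < N" "i \<notin> accepters N c w" for i
    using that speculator_lowest(1)[OF False]
    by (simp add: seller_payoff1_def bidder_payoff_def auction_wins_def)
  then have "(\<Sum>i<N. seller_payoff1 N r p c w i) = (\<Sum>i\<in>accepters N c w. seller_payoff1 N r p c w i)"
    using accepters_subset by (intro sum.mono_neutral_right) auto
  also have "\<dots> = p * real (card (accepters N c w)) - (\<Sum>i\<in>accepters N c w. w i)"
    by (simp add: seller_payoff1_def sum_subtractf)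
  finally show ?thesis
    using False by (simp add: surplus1_def speculator_payoff_eq auctioneer_payoff1_eq)
qed

text \<open>Rejecters have values at least \<open>c\<close>, so the overall cheapest seller is an
  accepter. The loss is therefore the sum of the accepters' values minus their minimum; splitting
  off \<open>w k\<close> separates the two terms.\<close>

lemma surplus_difference:
  assumes "accepters N c w \<noteq> {} \<Longrightarrow> k \<in> accepters N c w"
  shows "surplus0 A N r w - surplus1 A N r p c w
    = destroyed_value N c k w + misallocation N c k w"
proof (cases "accepters N c w = {}")
  case True
  then show ?thesis by (simp add: surplus1_eq destroyed_value_def misallocation_def)
next
  case False
  let ?S = "accepters N c w"
  have k: "k \<in> ?S" using assms False by blast
  then have N: "0 < N" and wk: "w k < c" "k < N" by (auto simp: accepters_def)
  have "Min (w ` ?S) \<in> w ` ?S" using False by (intro Min_in) auto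
  then obtain j where j: "j \<in> ?S" "w j = Min (w ` ?S)" by auto
  have "Min (w ` {..<N}) = Min (w ` ?S)"
  proof (rule Min_eqI)
    fix y assume "y \<in> w ` {..<N}"
    then obtain i where i: "i < N" "y = w i" by auto
    show "Min (w ` ?S) \<le> y"
    proof (cases "i \<in> ?S")
      case True
      then show ?thesis using i by simp
    next
      case False
      then have "c \<le> w i" using i by (simp add: accepters_def)
      then show ?thesis using i j by (simp add: accepters_def)
    qed
  next
    show "Min (w ` ?S) \<in> w ` {..<N}"
      using j accepters_subset[of N c w] by (metis image_eqI subsetD)
  qed simp
  moreover have "\<exists>i<N. w i \<le> r" using wk c_le by force
  ultimately have "surplus0 A N r w = A - Min (w ` ?S)"
    using N by (simp add: surplus0_eq)
  moreover have "(\<Sum>i\<in>?S. w i) = w k + (\<Sum>i\<in>?S - {k}. w i)"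
    using k by (intro sum.remove) auto
  ultimately show ?thesis
    using False by (simp add: surplus1_eq destroyed_value_def misallocation_def)
qed

text \<open>
  With a single accepter, the remaining bids, and hence the price, are those of the auction without
  the speculator; with two accepters the price without the speculator lies below c.
\<close>

lemma auctioneer_payoff1_le: "auctioneer_payoff1 A N r c w \<le> auctioneer_payoff0 A N r w"
  and auctioneer_payoff1_less:
    "\<And>i j. i < N \<Longrightarrow> j < N \<Longrightarrow> i \<noteq> j \<Longrightarrow> w i < c \<Longrightarrow> w j < c
      \<Longrightarrow> auctioneer_payoff1 A N r c w < auctioneer_payoff0 A N r w"
proof -
  let ?S = "accepters N c w" and ?m = "\<lambda>i. capped_min r ({..<N} - {i}) w"
  note R = capped_min_rejecters_ge and less = capped_min_others_less
  \<comment> \<open>An accepter's value is below \<open>c \<le> r\<close>, so a sale takes place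
    without the speculator.\<close>
  have pay0: "auctioneer_payoff0 A N r w = A - Max (?m ` {..<N})" if "i \<in> ?S" for i
    using that c_le by (subst auctioneer_payoff0_eq) (auto simp: accepters_def intro!: exI[of _ i])
  show "auctioneer_payoff1 A N r c w \<le> auctioneer_payoff0 A N r w"
  proof (cases "?S = {}")
    case True
    then show ?thesis by (simp add: auctioneer_payoff1_eq)
  next
    case False
    then obtain i where i: "i \<in> ?S" by auto
    \<comment> \<open>If \<open>k\<close> is the only accepter, both sides agree. Otherwise an
      accepter other than \<open>k\<close> remains, so the left side is below \<open>c\<close> and
      the right side is not.\<close>
    have "?m k \<le> capped_min r ({..<N} - ?S) w" for k
    proof (cases "?S \<subseteq> {k}")
      case True
      then have "?S = {k}" using i by auto
      then show ?thesis by simp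
    next
      case False
      then show ?thesis using less R by fastforce
    qed
    moreover have "{..<N} \<noteq> {}" using i by (auto simp: accepters_def)
    ultimately show ?thesis using False pay0[OF i] by (simp add: auctioneer_payoff1_eq)
  qed
  show "auctioneer_payoff1 A N r c w < auctioneer_payoff0 A N r w"
    if "i < N" "j < N" "i \<noteq> j" "w i < c" "w j < c" for i j
  proof -
    have ij: "i \<in> ?S" "j \<in> ?S" using that by (auto simp: accepters_def)
    have "?m k < c" for k using less ij \<open>i \<noteq> j\<close> by metis
    moreover have "{..<N} \<noteq> {}" using that by auto
    ultimately have "Max (?m ` {..<N}) < c" by simp
    then show ?thesis using ij R pay0[OF ij(1)] by (auto simp: auctioneer_payoff1_eq)
  qed
qed

end

subsection \<open>Independent identically distributed values\<close>


lemma borel_measurable_capped_min [measurable (raw)]: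
  assumes "finite I" "\<And>i. i \<in> I \<Longrightarrow> g i \<in> borel_measurable M"
  shows "(\<lambda>\<omega>. capped_min r I (\<lambda>i. g i \<omega>)) \<in> borel_measurable M"
proof (cases "I = {}")
  case True
  then show ?thesis by (simp add: capped_min_def)
next
  case False
  then have "capped_min r I (\<lambda>i. g i \<omega>) = min r (Min ((\<lambda>i. g i \<omega>) ` I))" for \<omega>
    using assms by (simp add: capped_min_def)
  then show ?thesis using assms by simp
qed

text \<open>A value replaced by \<open>r\<close> does not affect the capped minimum. This trades the
  random index set for a fixed one and so yields measurability.\<close>

lemma capped_min_rejecters_eq:
  "capped_min r ({..<N} - accepters N c w) w = capped_min r {..<N} (\<lambda>j. if w j < c then r else w j)"
proof (rule antisym)
  show "capped_min r ({..<N} - accepters N c w) w \<le> capped_min r {..<N} (\<lambda>j. if w j < c then r else w j)"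
    by (simp add: capped_min_ge_iff capped_min_le_cap capped_min_le accepters_def)
  have "capped_min r {..<N} (\<lambda>j. if w j < c then r else w j) \<le> w j" if "j < N" "\<not> w j < c" for j
    using capped_min_le[of "{..<N}" j r "\<lambda>j. if w j < c then r else w j"] that by simp
  then show "capped_min r {..<N} (\<lambda>j. if w j < c then r else w j)
      \<le> capped_min r ({..<N} - accepters N c w) w"
    by (auto simp: capped_min_ge_iff capped_min_le_cap accepters_def)
qed

lemma integrable_If:
  fixes f g :: "'a \<Rightarrow> real"
  assumes "integrable M f" "integrable M g" "Measurable.pred M P"
  shows "integrable M (\<lambda>x. if P x then f x else g x)"
proof (rule Bochner_Integration.integrable_bound)
  show "integrable M (\<lambda>x. \<bar>f x\<bar> + \<bar>g x\<bar>)" using assms by auto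
  show "(\<lambda>x. if P x then f x else g x) \<in> borel_measurable M"
    using assms by measurable
qed auto

section \<open>Common distribution of the values\<close>

locale iid_values = prob_space M for M :: "'w measure" +
  fixes v :: "nat \<Rightarrow> 'w \<Rightarrow> real" and f F :: "real \<Rightarrow> real" and N :: nat
  assumes N: "2 \<le> N"
    and indep: "indep_vars (\<lambda>_. borel) v {..<N}"
    and distributed_v: "\<And>i. i < N \<Longrightarrow> distributed M lborel (v i) (\<lambda>x. ennreal (f x))"
    and F_def: "F = cdf (density lborel (\<lambda>x. ennreal (f x)))"
    and F_0: "F 0 = 0" and F_1: "F 1 = 1" and F_pos: "\<And>x. 0 < x \<Longrightarrow> x \<le> 1 \<Longrightarrow> 0 < F x"
begin

lemma measurable_v [measurable]: "i < N \<Longrightarrow> v i \<in> borel_measurable M"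
  using distributed_measurable[OF distributed_v] by simp

lemma prob_v:
  assumes "i < N" "S \<in> sets borel"
  shows "prob {\<omega> \<in> space M. v i \<omega> \<in> S} = measure (density lborel (\<lambda>x. ennreal (f x))) S"
proof -
  have "measure (density lborel (\<lambda>x. ennreal (f x))) S = measure (distr M lborel (v i)) S"
    using distributed_distr_eq_density[OF distributed_v[OF assms(1)]] by simp
  also have "\<dots> = prob (v i -` S \<inter> space M)"
    using assms by (intro measure_distr) auto
  also have "v i -` S \<inter> space M = {\<omega> \<in> space M. v i \<omega> \<in> S}" by auto
  finally show ?thesis ..
qed

text \<open>A law with a density has no atoms. Continuity of \<open>F\<close> and the equal
  probabilities of strict and weak inequalities rest on this.\<close>

lemma prob_v_eq: "i < N \<Longrightarrow> prob {\<omega> \<in> space M. v i \<omega> = x} = 0"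
proof -
  assume i: "i < N"
  have "measure (density lborel (\<lambda>x. ennreal (f x))) {x} = 0"
    using distributed_borel_measurable[OF distributed_v[OF i]]
    by (simp add: measure_def emeasure_density nn_integral_indicator_singleton')
  then show ?thesis using prob_v[OF i, of "{x}"] by simp
qed

lemma real_distribution_density: "real_distribution (density lborel (\<lambda>x. ennreal (f x)))"
proof -
  have i: "0 < N" using N by simp
  interpret D: prob_space "density lborel (\<lambda>x. ennreal (f x))"
    unfolding distributed_distr_eq_density[OF distributed_v[OF i], symmetric]
    using i by (intro prob_space_distr) simp
  show ?thesis by unfold_locales simp_all
qed

lemma F_isCont: "isCont F x"
proof -
  interpret D: real_distribution "density lborel (\<lambda>x. ennreal (f x))"
    by (rule real_distribution_density)
  have "0 < N" using N by simp
  from prob_v[OF this, of "{x}"] prob_v_eq[OF this] show ?thesis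
    unfolding F_def D.isCont_cdf by simp
qed

lemma F_continuous_on: "continuous_on S F"
  using F_isCont by (simp add: continuous_at_imp_continuous_on)

lemma F_nonneg: "0 \<le> F x" and F_le_1: "F x \<le> 1"
proof -
  interpret D: real_distribution "density lborel (\<lambda>x. ennreal (f x))"
    by (rule real_distribution_density)
  show "0 \<le> F x" "F x \<le> 1" unfolding F_def by (rule D.cdf_nonneg, rule D.cdf_bounded_prob)
qed

lemma prob_v_le: "i < N \<Longrightarrow> prob {\<omega> \<in> space M. v i \<omega> \<le> x} = F x"
  using prob_v[of i "{..x}"] by (simp add: F_def cdf_def)

lemma prob_v_less:
  assumes i: "i < N"
  shows "prob {\<omega> \<in> space M. v i \<omega> < x} = F x"
proof -
  have "F x = prob ({\<omega> \<in> space M. v i \<omega> < x} \<union> {\<omega> \<in> space M. v i \<omega> = x})"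
    unfolding prob_v_le[OF i, symmetric] by (intro arg_cong[of _ _ prob]) auto
  also have "\<dots> = prob {\<omega> \<in> space M. v i \<omega> < x} + prob {\<omega> \<in> space M. v i \<omega> = x}"
    using i by (intro finite_measure_Union) auto
  finally show ?thesis using prob_v_eq[OF i] by simp
qed

lemma prob_v_gr:
  assumes i: "i < N"
  shows "prob {\<omega> \<in> space M. x < v i \<omega>} = 1 - F x"
proof -
  have "prob {\<omega> \<in> space M. \<not> v i \<omega> \<le> x} = 1 - prob {\<omega> \<in> space M. v i \<omega> \<le> x}"
    using i by (intro prob_neg) simp
  then show ?thesis using prob_v_le[OF i] by (simp add: not_le)
qed

text \<open>The left end is strict because \<open>F 0 = 0\<close>; this later makes the destroyed
  value positive.\<close>

lemma AE_v: "AE \<omega> in M. \<forall>i<N. 0 < v i \<omega> \<and> v i \<omega> \<le> 1"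
proof -
  have "AE \<omega> in M. 0 < v i \<omega>" "AE \<omega> in M. v i \<omega> \<le> 1" if i: "i < N" for i
    using prob_v_gr[OF i, of 0] prob_v_le[OF i, of 1] i F_0 F_1
      prob_Collect_eq_1[of "\<lambda>\<omega>. 0 < v i \<omega>"] prob_Collect_eq_1[of "\<lambda>\<omega>. v i \<omega> \<le> 1"] by simp_all
  then have "AE \<omega> in M. \<forall>i\<in>{..<N}. 0 < v i \<omega> \<and> v i \<omega> \<le> 1"
    by (intro AE_finite_allI) auto
  then show ?thesis by (simp add: Ball_def)
qed

lemma prob_Ball:
  assumes "J \<noteq> {}" "J \<subseteq> {..<N}" "\<And>i. i \<in> J \<Longrightarrow> S i \<in> sets borel"
  shows "prob {\<omega> \<in> space M. \<forall>i\<in>J. v i \<omega> \<in> S i} = (\<Prod>i\<in>J. prob {\<omega> \<in> space M. v i \<omega> \<in> S i})"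
proof -
  have J: "finite J" using assms(2) finite_subset by blast
  have "prob (\<Inter>i\<in>J. v i -` S i \<inter> space M) = (\<Prod>i\<in>J. prob (v i -` S i \<inter> space M))"
    using assms J by (intro indep_varsD[OF indep]) auto
  moreover have "(\<Inter>i\<in>J. v i -` S i \<inter> space M) = {\<omega> \<in> space M. \<forall>i\<in>J. v i \<omega> \<in> S i}"
    using assms(1) by auto
  moreover have "v i -` S i \<inter> space M = {\<omega> \<in> space M. v i \<omega> \<in> S i}" for i by auto
  ultimately show ?thesis by simp
qed

lemma prob_two_less:
  assumes "i < N" "j < N" "i \<noteq> j"
  shows "prob {\<omega> \<in> space M. v i \<omega> < c \<and> v j \<omega> < c} = F c * F c"
  using prob_Ball[of "{i, j}" "\<lambda>_. {..<c}"] assms prob_v_less by simp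

text \<open>
  In the truthful auction among the sellers, seller i wins if his value is below this amount,
  which he is then paid.
\<close>

definition others_min :: "real \<Rightarrow> nat \<Rightarrow> 'w \<Rightarrow> real" where
  "others_min r i \<omega> = capped_min r ({..<N} - {i}) (\<lambda>j. v j \<omega>)"

lemma others_min_le: "others_min r i \<omega> \<le> r"
  by (simp add: others_min_def capped_min_le_cap)

lemma borel_measurable_others_min [measurable]: "others_min r i \<in> borel_measurable M"
  unfolding others_min_def by (intro borel_measurable_capped_min) auto

lemma others_nonempty: "{..<N} - {i} \<noteq> {}"
proof -
  have "(if i = 0 then 1 else 0) \<in> {..<N} - {i}" using N by auto
  then show ?thesis by blast
qed

text \<open>Below the cap, all \<open>N - 1\<close> competitors must exceed \<open>x\<close>. This
  is where the integrand in \<open>cutoff\<close> comes from.\<close>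

lemma prob_others_min_gr:
  assumes "i < N" "x < r"
  shows "prob {\<omega> \<in> space M. x < others_min r i \<omega>} = (1 - F x) ^ (N - 1)"
proof -
  have "prob {\<omega> \<in> space M. \<forall>j\<in>{..<N} - {i}. v j \<omega> \<in> {x<..}} = (\<Prod>j\<in>{..<N} - {i}. 1 - F x)"
    using others_nonempty prob_v_gr by (subst prob_Ball) auto
  then show ?thesis using assms by (simp add: others_min_def capped_min_gr_iff)
qed

text \<open>The minimum involves the other sellers only. Independence is obtained for the uncapped
  minimum and passes to the capped one by composition with \<open>min r\<close>.\<close>

lemma indep_others_min:
  assumes "i < N"
  shows "indep_var borel (v i) borel (others_min r i)"
proof -
  let ?J = "{..<N} - {i}"
  have "insert i ?J = {..<N}" using assms by auto
  then have "indep_var borel (v i) borel (\<lambda>\<omega>. Min ((\<lambda>j. v j \<omega>) ` ?J))"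
    using indep by (intro indep_vars_Min) auto
  then have "indep_var borel ((\<lambda>x. x) \<circ> v i) borel (min r \<circ> (\<lambda>\<omega>. Min ((\<lambda>j. v j \<omega>) ` ?J)))"
    by (rule indep_var_compose) auto
  moreover have "min r \<circ> (\<lambda>\<omega>. Min ((\<lambda>j. v j \<omega>) ` ?J)) = others_min r i"
    using others_nonempty by (auto simp: fun_eq_iff others_min_def capped_min_def)
  ultimately show ?thesis by (simp add: comp_def)
qed

lemma integrable_v: "i < N \<Longrightarrow> integrable M (v i)"
  using AE_v by (intro integrable_const_bound[where B = 1]) (auto elim!: eventually_mono)

lemma integrable_others_min: "0 \<le> r \<Longrightarrow> integrable M (others_min r i)"
proof (rule integrable_const_bound[where B = r])
  assume r: "0 \<le> r"
  have "0 \<le> others_min r i \<omega>" if "\<forall>i<N. 0 < v i \<omega> \<and> v i \<omega> \<le> 1" for \<omega>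
    using that r by (force simp: others_min_def capped_min_ge_iff)
  then show "AE \<omega> in M. norm (others_min r i \<omega>) \<le> r"
    using AE_v others_min_le by (auto elim!: eventually_mono)
qed simp

text \<open>Layer-cake formula: the excess of the maximum over \<open>c\<close> is the length of the
  set of \<open>x \<ge> c\<close> with \<open>x < ?m \<omega>\<close>. Exchanging the integrals
  turns it into an integral of tail probabilities.\<close>

lemma expectation_max_others_min:
  assumes i: "i < N" and c: "0 \<le> c" "c \<le> r"
  shows "expectation (\<lambda>\<omega>. max c (others_min r i \<omega>)) = c + integral {c..r} (\<lambda>x. (1 - F x) ^ (N - 1))"
proof -
  let ?H = "\<lambda>x. (1 - F x) ^ (N - 1)"
  let ?m = "others_min r i"
  define g :: "'w \<Rightarrow> real \<Rightarrow> real" where "g = (\<lambda>\<omega> x. if c \<le> x \<and> x < ?m \<omega> then 1 else 0)"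
  have le: "x < ?m \<omega> \<Longrightarrow> x \<le> r" for x \<omega>
    using others_min_le[of r i \<omega>] by linarith
  interpret P: pair_sigma_finite M lborel ..
  have inner: "(\<integral>x. g \<omega> x \<partial>lborel) = max c (?m \<omega>) - c" for \<omega>
  proof -
    \<comment> \<open>If \<open>?m \<omega> \<le> c\<close>, both sides vanish.\<close>
    have "g \<omega> = indicator {c..<max c (?m \<omega>)}"
      by (auto simp: g_def fun_eq_iff indicator_def)
    then show ?thesis by simp
  qed
  have meas: "case_prod g \<in> borel_measurable (M \<Otimes>\<^sub>M lborel)"
    unfolding g_def by measurable
  \<comment> \<open>Since \<open>?m\<close> is at most \<open>r\<close>, the integrand is supported
    in \<open>space M \<times> {c..r}\<close>, a set of finite measure.\<close>
  have "integrable (M \<Otimes>\<^sub>M lborel) (case_prod g)"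
  proof (rule Bochner_Integration.integrable_bound[OF _ meas])
    have "emeasure (M \<Otimes>\<^sub>M lborel) (space M \<times> {c..r}) < \<infinity>"
      using c by (simp add: lborel.emeasure_pair_measure_Times emeasure_space_1)
    then show "integrable (M \<Otimes>\<^sub>M lborel) (indicator (space M \<times> {c..r}) :: _ \<Rightarrow> real)"
      by (simp add: integrable_indicator_iff)
    show "AE y in M \<Otimes>\<^sub>M lborel. norm (case_prod g y) \<le> norm (indicator (space M \<times> {c..r}) y :: real)"
      using le by (intro AE_I2) (auto simp: g_def space_pair_measure indicator_def split: if_splits)
  qed
  then have swap: "(\<integral>x. (\<integral>\<omega>. g \<omega> x \<partial>M) \<partial>lborel) = (\<integral>\<omega>. (\<integral>x. g \<omega> x \<partial>lborel) \<partial>M)"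
    by (rule P.Fubini_integral)
  \<comment> \<open>At \<open>x = r\<close> the left side is 0 because of the cap, while the right
    side need not be; a single point does not matter.\<close>
  have "(\<integral>\<omega>. g \<omega> x \<partial>M) = indicator {c..r} x *\<^sub>R ?H x" if ne: "x \<noteq> r" for x
  proof -
    consider "x < c" | "r < x" | "c \<le> x" "x < r" using ne by linarith
    then show ?thesis
    proof cases
      case 1
      then show ?thesis by (simp add: g_def)
    next
      case 2
      then have "g \<omega> x = 0" for \<omega> using others_min_le[of r i \<omega>] by (auto simp: g_def)
      then show ?thesis using 2 by simp
    next
      case 3
      have "(\<integral>\<omega>. g \<omega> x \<partial>M) = (\<integral>\<omega>. indicator {\<omega> \<in> space M. x < ?m \<omega>} \<omega> \<partial>M)"
        using 3 by (intro Bochner_Integration.integral_cong) (auto simp: g_def)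
      then show ?thesis using 3 prob_others_min_gr[OF i 3(2)] by simp
    qed
  qed
  then have "(\<integral>x. (\<integral>\<omega>. g \<omega> x \<partial>M) \<partial>lborel) = (\<integral>x. indicator {c..r} x *\<^sub>R ?H x \<partial>lborel)"
  proof (intro integral_cong_AE)
    have "case_prod (\<lambda>x \<omega>. g \<omega> x) \<in> borel_measurable (lborel \<Otimes>\<^sub>M M)"
      unfolding g_def by measurable
    then show "(\<lambda>x. \<integral>\<omega>. g \<omega> x \<partial>M) \<in> borel_measurable lborel"
      by (rule borel_measurable_lebesgue_integral)
    have "?H \<in> borel_measurable borel"
      by (intro borel_measurable_continuous_onI continuous_intros F_continuous_on)
    then show "(\<lambda>x. indicator {c..r} x *\<^sub>R ?H x) \<in> borel_measurable lborel" by simp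
  qed (use AE_lborel_singleton[of r] in \<open>auto elim!: eventually_mono\<close>)
  also have "\<dots> = integral {c..r} ?H"
    using set_borel_integral_eq_integral(2)[of "{c..r}" ?H]
      borel_integrable_atLeastAtMost'[of c r ?H]
    by (simp add: set_lebesgue_integral_def continuous_intros F_continuous_on)
  finally have "expectation (\<lambda>\<omega>. max c (?m \<omega>) - c) = integral {c..r} ?H"
    using swap by (simp add: inner)
  moreover have "integrable M (\<lambda>\<omega>. max c (?m \<omega>))"
    using integrable_others_min[of r i] c by auto
  ultimately show ?thesis by (simp add: prob_space)
qed

subsection \<open>The cutoff induced by an optimal offer\<close>

text \<open>The defining equation of \<open>cutoff\<close> solved for the offer: the price at which
  a seller of value \<open>c\<close> is indifferent. It parametrizes offers by cutoffs.\<close>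

definition acceptance_price :: "real \<Rightarrow> real \<Rightarrow> real" where
  "acceptance_price r c = c + integral {c..r} (\<lambda>x. (1 - F x) ^ (N - 1))"

lemma continuous_on_survival_power: "continuous_on S (\<lambda>x. (1 - F x) ^ (N - 1))"
  by (intro continuous_intros F_continuous_on)

text \<open>Raising the cutoff from \<open>a\<close> to \<open>b\<close> adds \<open>b - a\<close>
  and removes an integral over \<open>{a..b}\<close> whose integrand is below 1 where
  \<open>F\<close> is positive.\<close>

lemma acceptance_price_strict_mono:
  assumes "0 \<le> a" "a < b" "b \<le> r" "r \<le> 1"
  shows "acceptance_price r a < acceptance_price r b"
proof -
  let ?H = "\<lambda>x. (1 - F x) ^ (N - 1)"
  have "integral {a..b} ?H + integral {b..r} ?H = integral {a..r} ?H"
    using assms by (intro Henstock_Kurzweil_Integration.integral_combine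
        integrable_continuous_interval continuous_on_survival_power) auto
  moreover have "integral {a..b} ?H < integral {a..b} (\<lambda>_. 1)"
  proof (rule integral_less_real)
    fix x assume "x \<in> {a<..<b}"
    then have "0 < F x" using assms by (intro F_pos) auto
    then show "?H x < 1" using F_le_1[of x] N by (intro power_less_one_iff[THEN iffD2]) auto
  qed (use assms continuous_on_survival_power in auto)
  ultimately show ?thesis using assms by (simp add: acceptance_price_def)
qed

lemma acceptance_price_r [simp]: "acceptance_price r r = r"
  by (simp add: acceptance_price_def)

text \<open>Strict monotonicity rules out the zero branch of \<open>cutoff\<close> and gives the
  uniqueness needed for \<open>THE\<close>.\<close>

lemma cutoff_acceptance_price:
  assumes "0 < c" "c \<le> r" "r \<le> 1"
  shows "cutoff F N r (acceptance_price r c) = c"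
proof -
  let ?H = "\<lambda>x. (1 - F x) ^ (N - 1)"
  have eq: "acceptance_price r c - d = integral {d..r} ?H \<longleftrightarrow> acceptance_price r d = acceptance_price r c" for d
    by (auto simp: acceptance_price_def)
  have "acceptance_price r 0 < acceptance_price r c"
    using assms by (intro acceptance_price_strict_mono) auto
  then have "\<not> acceptance_price r c \<le> integral {0..r} ?H"
    by (simp add: acceptance_price_def)
  moreover have "(THE d. 0 \<le> d \<and> d \<le> r \<and> acceptance_price r c - d = integral {d..r} ?H) = c"
  proof (rule the_equality)
    fix d assume "0 \<le> d \<and> d \<le> r \<and> acceptance_price r c - d = integral {d..r} ?H"
    then show "d = c"
      using acceptance_price_strict_mono[of c d r] acceptance_price_strict_mono[of d c r] assms eq[of d]
      by (cases d c rule: linorder_cases) auto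
  qed (use assms in \<open>auto simp: acceptance_price_def\<close>)
  ultimately show ?thesis by (simp add: cutoff_def)
qed

lemma acceptance_price_surj:
  assumes "acceptance_price r 0 < p" "p \<le> r" "0 < r"
  obtains c where "0 < c" "c \<le> r" "acceptance_price r c = p"
proof -
  have "continuous_on {0..r} (acceptance_price r)"
    unfolding acceptance_price_def
    by (intro continuous_intros indefinite_integral_continuous_1' integrable_continuous_interval
        continuous_on_survival_power)
  then obtain c where c: "0 \<le> c" "c \<le> r" "acceptance_price r c = p"
    using IVT'[of "acceptance_price r" 0 p r] assms by auto
  then show ?thesis using that[of c] assms by (cases "c = 0") auto
qed

text \<open>By independence, conditioning on acceptance does not change the mean of the maximum. In
  expectation, paying the fixed offer to an accepter is thus the same as paying him this random
  amount.\<close>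

lemma accepted_others_min:
  assumes i: "i < N" and c: "0 \<le> c" "c \<le> r"
  shows "expectation (\<lambda>\<omega>. if v i \<omega> < c then max c (others_min r i \<omega>) else 0)
    = F c * acceptance_price r c"
    and "integrable M (\<lambda>\<omega>. if v i \<omega> < c then max c (others_min r i \<omega>) else 0)"
proof -
  let ?X = "\<lambda>\<omega>. indicator {..<c} (v i \<omega>) :: real" and ?Y = "\<lambda>\<omega>. max c (others_min r i \<omega>)"
  have "indep_var borel (indicator {..<c} \<circ> v i) borel (max c \<circ> others_min r i)"
    using indep_others_min[OF i] by (rule indep_var_compose) auto
  then have ind: "indep_var borel ?X borel ?Y" by (simp add: comp_def)
  have X: "integrable M ?X"
    using i by (intro integrable_const_bound[where B = 1]) auto
  have Y: "integrable M ?Y"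
    using integrable_others_min[of r i] c by auto
  have eq: "(\<lambda>\<omega>. if v i \<omega> < c then ?Y \<omega> else 0) = (\<lambda>\<omega>. ?X \<omega> * ?Y \<omega>)"
    by (auto simp: fun_eq_iff)
  have "expectation ?X = expectation (indicator {\<omega> \<in> space M. v i \<omega> < c})"
    by (intro Bochner_Integration.integral_cong) (auto simp: indicator_def)
  also have "\<dots> = F c" using prob_v_less[OF i] i by simp
  finally show "expectation (\<lambda>\<omega>. if v i \<omega> < c then ?Y \<omega> else 0) = F c * acceptance_price r c"
    unfolding eq indep_var_lebesgue_integral[OF ind X Y]
    using expectation_max_others_min[OF i c] by (simp add: acceptance_price_def)
  show "integrable M (\<lambda>\<omega>. if v i \<omega> < c then ?Y \<omega> else 0)"
    unfolding eq using ind X Y by (rule indep_var_integrable)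
qed

lemma integrable_If_less:
  "i < N \<Longrightarrow> integrable M (\<lambda>\<omega>. if v i \<omega> < c then a else b :: real)"
  by (intro integrable_If) auto

lemma expectation_If_less:
  assumes i: "i < N"
  shows "expectation (\<lambda>\<omega>. if v i \<omega> < c then a else 0) = a * F c"
proof -
  have "expectation (\<lambda>\<omega>. if v i \<omega> < c then a else 0)
      = expectation (\<lambda>\<omega>. a * indicator {\<omega> \<in> space M. v i \<omega> < c} \<omega>)"
    by (intro Bochner_Integration.integral_cong) (auto simp: indicator_def)
  then show ?thesis using prob_v_less[OF i] i by simp
qed

lemma pred_accepters_empty [measurable]:
  "Measurable.pred M (\<lambda>\<omega>. accepters N c (\<lambda>i. v i \<omega>) = {})"
proof -
  have "accepters N c (\<lambda>i. v i \<omega>) = {} \<longleftrightarrow> (\<forall>i\<in>{..<N}. \<not> v i \<omega> < c)" for \<omega>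
    by (auto simp: accepters_def)
  then show ?thesis by (simp only:) measurable
qed

lemma borel_measurable_rejecters [measurable]:
  "(\<lambda>\<omega>. capped_min r ({..<N} - accepters N c (\<lambda>i. v i \<omega>)) (\<lambda>i. v i \<omega>)) \<in> borel_measurable M"
  unfolding capped_min_rejecters_eq by (intro borel_measurable_capped_min) auto

lemma integrable_rejecters:
  assumes "0 < c" "c \<le> r"
  shows "integrable M (\<lambda>\<omega>. capped_min r ({..<N} - accepters N c (\<lambda>i. v i \<omega>)) (\<lambda>i. v i \<omega>))"
proof (rule integrable_const_bound[where B = r])
  have "norm (capped_min r ({..<N} - accepters N c w) w) \<le> r" for w
    using capped_min_rejecters_ge[OF assms, of N w] assms(1)
      capped_min_le_cap[of "{..<N} - accepters N c w" r w] by simp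
  then show "AE \<omega> in M. norm (capped_min r ({..<N} - accepters N c (\<lambda>i. v i \<omega>)) (\<lambda>i. v i \<omega>)) \<le> r"
    by simp
qed simp

lemma sum_accepters:
  "(\<Sum>i\<in>accepters N c w. h i) = (\<Sum>i<N. if w i < c then h i else 0)"
  by (simp add: accepters_def sum.If_cases Int_def)

text \<open>Replacing the offer paid to each accepter by the random amount of the same mean gives a
  payoff that \<open>speculation_gain\<close> evaluates pointwise as \<open>G\<close>.\<close>

lemma expectation_speculator:
  assumes c: "0 < c" "c \<le> r"
  defines "R \<equiv> \<lambda>\<omega>. capped_min r ({..<N} - accepters N c (\<lambda>i. v i \<omega>)) (\<lambda>i. v i \<omega>)"
  defines "S \<equiv> \<lambda>\<omega>. accepters N c (\<lambda>i. v i \<omega>)"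
  defines "G \<equiv> \<lambda>\<omega>. if \<exists>i\<in>S \<omega>. \<exists>j\<in>S \<omega>. i \<noteq> j then R \<omega> - c * real (card (S \<omega>)) else 0"
  shows "integrable M G"
    and "expectation (\<lambda>\<omega>. speculator_payoff N r (acceptance_price r c) c (\<lambda>i. v i \<omega>)) = expectation G"
proof -
  let ?q = "acceptance_price r c"
  let ?P = "\<lambda>\<omega>. if S \<omega> = {} then 0 else R \<omega>"
  let ?Z = "\<lambda>i \<omega>. if v i \<omega> < c then max c (others_min r i \<omega>) else 0"
  have P: "integrable M ?P"
    unfolding R_def S_def using integrable_rejecters[OF c] by (intro integrable_If) auto
  have G: "G = (\<lambda>\<omega>. ?P \<omega> - (\<Sum>i<N. ?Z i \<omega>))"
    unfolding G_def S_def R_def others_min_def sum_accepters[symmetric]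
    by (rule ext) (rule speculation_gain[OF c, symmetric])
  have Z: "integrable M (?Z i)" "expectation (?Z i) = ?q * F c" if "i < N" for i
    using accepted_others_min[of i c r] that c by simp_all
  have sumZ: "integrable M (\<lambda>\<omega>. \<Sum>i<N. ?Z i \<omega>)"
    using Z by (intro Bochner_Integration.integrable_sum) simp
  show "integrable M G" unfolding G using P sumZ by (rule Bochner_Integration.integrable_diff)
  have "speculator_payoff N r ?q c (\<lambda>i. v i \<omega>) = ?P \<omega> - (\<Sum>i<N. if v i \<omega> < c then ?q else 0)" for \<omega>
    using speculator_payoff_eq[OF c, of N ?q]
    unfolding sum_accepters[symmetric] by (simp add: R_def S_def mult.commute)
  then have "expectation (\<lambda>\<omega>. speculator_payoff N r ?q c (\<lambda>i. v i \<omega>))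
      = expectation (\<lambda>\<omega>. ?P \<omega> - (\<Sum>i<N. if v i \<omega> < c then ?q else 0))"
    by presburger
  also have "\<dots> = expectation ?P - expectation (\<lambda>\<omega>. \<Sum>i<N. if v i \<omega> < c then ?q else 0)"
    using P by (intro Bochner_Integration.integral_diff Bochner_Integration.integrable_sum
        integrable_If_less) simp_all
  also have "expectation (\<lambda>\<omega>. \<Sum>i<N. if v i \<omega> < c then ?q else 0) = (\<Sum>i<N. ?q * F c)"
    using integrable_If_less expectation_If_less
    by (subst Bochner_Integration.integral_sum) simp_all
  \<comment> \<open>Here the fixed offer is exchanged for the random payment.\<close>
  also have "(\<Sum>i<N. ?q * F c) = expectation (\<lambda>\<omega>. \<Sum>i<N. ?Z i \<omega>)"
    using Z by (subst Bochner_Integration.integral_sum) simp_all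
  also have "expectation ?P - expectation (\<lambda>\<omega>. \<Sum>i<N. ?Z i \<omega>) = expectation G"
    unfolding G using P sumZ by (rule Bochner_Integration.integral_diff[symmetric])
  finally show "expectation (\<lambda>\<omega>. speculator_payoff N r ?q c (\<lambda>i. v i \<omega>)) = expectation G" .
qed

text \<open>For \<open>c \<le> t\<close> this is an event in which sellers 0 and 1 are the only
  accepters.\<close>

lemma prob_exactly_two:
  "prob {\<omega> \<in> space M. v 0 \<omega> < c \<and> v 1 \<omega> < c \<and> (\<forall>i\<in>{2..<N}. t < v i \<omega>)} = F c ^ 2 * (1 - F t) ^ (N - 2)"
proof -
  obtain k where k: "N = Suc (Suc k)" using N by (metis add_2_eq_Suc le_Suc_ex)
  define A where "A i = (if i < 2 then {..<c} else {t<..})" for i :: nat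
  have "prob {\<omega> \<in> space M. \<forall>i\<in>{..<N}. v i \<omega> \<in> A i} = (\<Prod>i<N. prob {\<omega> \<in> space M. v i \<omega> \<in> A i})"
    using N by (intro prob_Ball) (auto simp: A_def lessThan_empty_iff bot_nat_def)
  also have "\<dots> = (\<Prod>i<N. if i < 2 then F c else 1 - F t)"
    by (intro prod.cong) (auto simp: A_def prob_v_less prob_v_gr)
  also have "\<dots> = F c ^ 2 * (1 - F t) ^ (N - 2)"
    unfolding k prod.lessThan_Suc_shift by (simp add: power2_eq_square)
  also have "{..<N} = insert 0 (insert 1 {2..<N})" using N by auto
  finally show ?thesis by (simp add: A_def)
qed

text \<open>
  For small c the profit is of order F(c)^2: with two accepters and all other values above a fixed
  t the resale price is at least t, whereas two or more acquisitions cost at most N c.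
\<close>

lemma profitable_cutoff:
  assumes r: "0 < r"
  obtains c where "0 < c" "c \<le> r"
    "c \<le> 1 \<Longrightarrow> 0 < expectation (\<lambda>\<omega>. speculator_payoff N r (acceptance_price r c) c (\<lambda>i. v i \<omega>))"
proof -
  obtain t where t: "0 < t" "t \<le> r" "F t < 1"
  proof -
    \<comment> \<open>\<open>F\<close> is continuous and vanishes at 0, so it stays below 1 near
      0.\<close>
    have "eventually (\<lambda>x. F x < 1) (at 0)"
      using F_isCont[of 0] F_0 by (intro order_tendstoD(2)[of F 0]) (auto simp: isCont_def)
    then obtain d where d: "0 < d" "\<And>x. x \<noteq> 0 \<Longrightarrow> dist x 0 < d \<Longrightarrow> F x < 1"
      by (auto simp: eventually_at)
    then show ?thesis using r that[of "min r (d / 2)"] by (auto simp: min_def)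
  qed
  \<comment> \<open>By \<open>prob_exactly_two\<close>, \<open>t * prob E = F c ^ 2 * a\<close> for
    the event \<open>E\<close> below.\<close>
  define a where "a = t * (1 - F t) ^ (N - 2)"
  have a: "0 < a" using t by (simp add: a_def)
  \<comment> \<open>A cost of at most \<open>N * c\<close> is charged for each of
    \<open>N ^ 2\<close> ordered pairs, each of probability at most \<open>F c ^ 2\<close>. The
    total must stay below \<open>F c ^ 2 * a\<close>; the factor 2 makes this strict, and the
    minimum with \<open>t\<close> keeps \<open>c \<le> r\<close>.\<close>
  define c where "c = min t (a / (2 * real N ^ 3))"
  have c: "0 < c" "c \<le> r" using a t N by (auto simp: c_def)
  have Nc: "real N ^ 3 * c < a"
  proof -
    have "real N ^ 3 * c \<le> real N ^ 3 * (a / (2 * real N ^ 3))"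
      using N by (intro mult_left_mono) (auto simp: c_def)
    also have "\<dots> = a / 2" using N by simp
    finally show ?thesis using a by simp
  qed
  let ?S = "\<lambda>\<omega>. accepters N c (\<lambda>i. v i \<omega>)"
  let ?R = "\<lambda>\<omega>. capped_min r ({..<N} - ?S \<omega>) (\<lambda>i. v i \<omega>)"
  let ?G = "\<lambda>\<omega>. if \<exists>i\<in>?S \<omega>. \<exists>j\<in>?S \<omega>. i \<noteq> j then ?R \<omega> - c * real (card (?S \<omega>)) else 0"
  define E where "E = {\<omega> \<in> space M. v 0 \<omega> < c \<and> v 1 \<omega> < c \<and> (\<forall>i\<in>{2..<N}. t < v i \<omega>)}"
  \<comment> \<open>Ordered pairs of accepters; \<open>D i i\<close> is empty. Together these events
    cover the case in which \<open>?G\<close> is not zero by default.\<close>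
  define D where "D i j = {\<omega> \<in> space M. i \<noteq> j \<and> v i \<omega> < c \<and> v j \<omega> < c}" for i j
  have [measurable]: "v 0 \<in> borel_measurable M" "v 1 \<in> borel_measurable M"
    using N by (auto intro: measurable_v)
  have E: "E \<in> sets M" unfolding E_def by measurable
  have D: "D i j \<in> sets M" if "i < N" "j < N" for i j
    using that unfolding D_def by measurable
  \<comment> \<open>With several accepters the double sum is at least 1 and so covers the cost,
    while the resale price is at least \<open>t\<close> on \<open>E\<close> and positive elsewhere.
    With fewer accepters \<open>E\<close> fails and the left side is at most 0.\<close>
  have lower: "t * indicator E \<omega> - real N * c * (\<Sum>i<N. \<Sum>j<N. indicator (D i j) \<omega>) \<le> ?G \<omega>"
    if \<omega>: "\<omega> \<in> space M" for \<omega>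
  proof (cases "\<exists>i\<in>?S \<omega>. \<exists>j\<in>?S \<omega>. i \<noteq> j")
    case True
    then obtain i j where ij: "i < N" "j < N" "i \<noteq> j" "v i \<omega> < c" "v j \<omega> < c"
      by (auto simp: accepters_def)
    have "1 = (indicator (D i j) \<omega> :: real)" using ij \<omega> by (simp add: D_def)
    also have "\<dots> \<le> (\<Sum>j<N. indicator (D i j) \<omega>)"
      using ij by (intro member_le_sum) auto
    also have "\<dots> \<le> (\<Sum>i<N. \<Sum>j<N. indicator (D i j) \<omega>)"
      using ij by (intro member_le_sum[of i "{..<N}" "\<lambda>i. \<Sum>j<N. indicator (D i j) \<omega>"])
        (auto intro!: sum_nonneg)
    finally have sum: "1 \<le> (\<Sum>i<N. \<Sum>j<N. indicator (D i j) \<omega> :: real)" .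
    have "real (card (?S \<omega>)) \<le> real N"
      using card_mono[OF _ accepters_subset, of N c "\<lambda>i. v i \<omega>"] by simp
    then have "c * real (card (?S \<omega>)) \<le> c * real N" using c by simp
    also have "\<dots> \<le> c * real N * (\<Sum>i<N. \<Sum>j<N. indicator (D i j) \<omega>)"
      using mult_left_mono[OF sum, of "c * real N"] c by simp
    finally have cost: "c * real (card (?S \<omega>)) \<le> real N * c * (\<Sum>i<N. \<Sum>j<N. indicator (D i j) \<omega>)"
      by (simp add: mult.commute)
    have "t * indicator E \<omega> \<le> ?R \<omega>"
    proof (cases "\<omega> \<in> E")
      case True
      have "t \<le> v j \<omega>" if "j \<in> {..<N} - ?S \<omega>" for j
      proof -
        have "j \<noteq> 0" "j \<noteq> 1" "j < N"
          using that True by (auto simp: E_def accepters_def intro!: gr0I)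
        then have "j \<in> {2..<N}" by auto
        then show ?thesis using True by (auto simp: E_def intro: less_imp_le)
      qed
      then show ?thesis using True t by (simp add: capped_min_ge_iff)
    next
      case False
      then show ?thesis using capped_min_rejecters_ge[OF c, of N "\<lambda>i. v i \<omega>"] c by simp
    qed
    then show ?thesis using True cost by simp
  next
    case False
    have "\<omega> \<notin> E"
    proof
      assume "\<omega> \<in> E"
      then have "0 \<in> ?S \<omega>" "1 \<in> ?S \<omega>" using N by (auto simp: E_def accepters_def)
      then show False using False by (metis zero_neq_one)
    qed
    moreover have "0 \<le> real N * c * (\<Sum>i<N. \<Sum>j<N. indicator (D i j) \<omega>)"
      using c by (intro mult_nonneg_nonneg sum_nonneg) auto
    ultimately show ?thesis using False by simp
  qed
  have intD: "integrable M (indicator (D i j) :: _ \<Rightarrow> real)"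
    and expD: "expectation (indicator (D i j)) = prob (D i j)" if "i < N" "j < N" for i j
    using D[OF that] by (simp_all add: emeasure_eq_measure)
  have intE: "integrable M (indicator E :: _ \<Rightarrow> real)"
    using E by (simp_all add: emeasure_eq_measure)
  have integrable_lower: "integrable M (\<lambda>\<omega>. t * indicator E \<omega>)"
    "integrable M (\<lambda>\<omega>. real N * c * (\<Sum>i<N. \<Sum>j<N. indicator (D i j) \<omega>))"
    using intE intD by (auto intro!: integrable_mult_right Bochner_Integration.integrable_sum)
  have expectation_sum: "expectation (\<lambda>\<omega>. \<Sum>i<N. \<Sum>j<N. indicator (D i j) \<omega>)
      = (\<Sum>i<N. \<Sum>j<N. prob (D i j))"
    using intD expD
    by (subst Bochner_Integration.integral_sum, force intro: Bochner_Integration.integrable_sum)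
      (intro sum.cong refl, subst Bochner_Integration.integral_sum, auto)
  have probD: "prob (D i j) \<le> F c ^ 2" if "i < N" "j < N" for i j
    using prob_two_less[of i j c] that by (cases "i = j") (auto simp: D_def power2_eq_square F_nonneg)
  have "(\<Sum>i<N. \<Sum>j<N. prob (D i j)) \<le> (\<Sum>i<N. \<Sum>j<N. F c ^ 2)"
    using probD by (intro sum_mono) auto
  also have "\<dots> = real N ^ 2 * F c ^ 2" by (simp add: power2_eq_square)
  finally have sumD: "real N * c * (\<Sum>i<N. \<Sum>j<N. prob (D i j)) \<le> real N * c * (real N ^ 2 * F c ^ 2)"
    using c by (intro mult_left_mono) auto
  have "F c ^ 2 * (a - real N ^ 3 * c) = t * prob E - real N * c * (real N ^ 2 * F c ^ 2)"
    unfolding E_def prob_exactly_two by (simp add: a_def algebra_simps power2_eq_square power3_eq_cube)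
  also have "\<dots> \<le> t * prob E - real N * c * (\<Sum>i<N. \<Sum>j<N. prob (D i j))"
    using sumD by simp
  also have "\<dots> = expectation (\<lambda>\<omega>. t * indicator E \<omega>)
      - expectation (\<lambda>\<omega>. real N * c * (\<Sum>i<N. \<Sum>j<N. indicator (D i j) \<omega>))"
    unfolding Bochner_Integration.integral_mult_right_zero expectation_sum by (simp add: E)
  also have "\<dots> = expectation (\<lambda>\<omega>. t * indicator E \<omega> - real N * c * (\<Sum>i<N. \<Sum>j<N. indicator (D i j) \<omega>))"
    using integrable_lower by (intro Bochner_Integration.integral_diff[symmetric])
  also have "\<dots> \<le> expectation ?G"
    using integrable_lower lower
    by (intro integral_mono Bochner_Integration.integrable_diff expectation_speculator(1)[OF c])
  finally have "F c ^ 2 * (a - real N ^ 3 * c)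
      \<le> expectation (\<lambda>\<omega>. speculator_payoff N r (acceptance_price r c) c (\<lambda>i. v i \<omega>))"
    using expectation_speculator(2)[OF c] by simp
  moreover have "0 < F c ^ 2 * (a - real N ^ 3 * c)" if "c \<le> 1"
    using Nc F_pos[OF c(1) that] by simp
  ultimately show ?thesis using that[OF c] by fastforce
qed

text \<open>An optimal offer earns at least the positive profit from
  \<open>profitable_cutoff\<close>, whereas an offer inducing cutoff 0 earns nothing. Hence
  \<open>p\<close> exceeds the acceptance price of cutoff 0, and the intermediate value theorem
  supplies a positive cutoff.\<close>

lemma optimal_offer_cutoff:
  assumes r: "0 < r" "r \<le> 1" and opt: "optimal_offer M v F N r p"
  shows "0 < cutoff F N r p" "cutoff F N r p \<le> r" "acceptance_price r (cutoff F N r p) = p"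
proof -
  obtain d where d: "0 < d" "d \<le> r"
    and pos: "0 < expectation (\<lambda>\<omega>. speculator_payoff N r (acceptance_price r d) d (\<lambda>i. v i \<omega>))"
    using profitable_cutoff[OF r(1)] r(2) by (metis order_trans)
  have "acceptance_price r d \<le> acceptance_price r r"
    using acceptance_price_strict_mono[of d r r] d r by (cases "d = r") auto
  \<comment> \<open>Optimality compares only with offers in \<open>{0..r}\<close>, so the deviation
    has to be admissible.\<close>
  moreover have "0 \<le> acceptance_price r d"
    using d unfolding acceptance_price_def
    by (intro add_nonneg_nonneg integral_nonneg integrable_continuous_interval continuous_on_survival_power)
       (auto simp: F_le_1)
  ultimately have "acceptance_price r d \<in> {0..r}" by simp
  then have "expectation (\<lambda>\<omega>. speculator_payoff N r (acceptance_price r d)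
        (cutoff F N r (acceptance_price r d)) (\<lambda>i. v i \<omega>))
      \<le> expectation (\<lambda>\<omega>. speculator_payoff N r p (cutoff F N r p) (\<lambda>i. v i \<omega>))"
    using opt unfolding optimal_offer_def by blast
  then have gain: "0 < expectation (\<lambda>\<omega>. speculator_payoff N r p (cutoff F N r p) (\<lambda>i. v i \<omega>))"
    using pos cutoff_acceptance_price[OF d r(2)] by simp
  have "acceptance_price r 0 < p"
  proof (rule ccontr)
    assume "\<not> acceptance_price r 0 < p"
    then have zero: "cutoff F N r p = 0" by (simp add: cutoff_def acceptance_price_def)
    \<comment> \<open>At cutoff 0 only negative values would accept.\<close>
    have "AE \<omega> in M. speculator_payoff N r p 0 (\<lambda>i. v i \<omega>) = 0"
      using AE_v
    proof eventually_elim
      case (elim \<omega>)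
      then have "accepters N 0 (\<lambda>i. v i \<omega>) = {}" by (force simp: accepters_def)
      then show ?case
        by (simp add: speculator_payoff_def bidder_payoff_def auction_wins_def
            spec_bidders_no_accepters)
    qed
    then have "expectation (\<lambda>\<omega>. speculator_payoff N r p 0 (\<lambda>i. v i \<omega>)) = 0"
      by (rule integral_eq_zero_AE)
    then show False using gain zero by simp
  qed
  then obtain c where "0 < c" "c \<le> r" "acceptance_price r c = p"
    using acceptance_price_surj opt r unfolding optimal_offer_def by (metis atLeastAtMost_iff)
  then show "0 < cutoff F N r p" "cutoff F N r p \<le> r" "acceptance_price r (cutoff F N r p) = p"
    using cutoff_acceptance_price[of c r] r by auto
qed

subsection \<open>Comparison of the expected payoffs\<close>

lemma seller_payoff0_others_min:
  "i < N \<Longrightarrow> seller_payoff0 N r (\<lambda>j. v j \<omega>) i = max 0 (others_min r i \<omega> - v i \<omega>)"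
  by (simp add: seller_payoff0_eq others_min_def)

text \<open>Overriding seller \<open>i\<close>'s own value leaves \<open>others_min\<close>
  untouched; this is the interim view of a seller who knows his value.\<close>

lemma seller_payoff0_update:
  assumes "i < N"
  shows "seller_payoff0 N r ((\<lambda>j. v j \<omega>)(i := x)) i = max 0 (others_min r i \<omega> - x)"
  unfolding seller_payoff0_eq[OF assms] others_min_def
  by (intro arg_cong2[of _ _ _ _ max] arg_cong2[of _ _ _ _ minus] capped_min_cong) auto

lemma others_min_less: "j < N \<Longrightarrow> j \<noteq> i \<Longrightarrow> v j \<omega> < c \<Longrightarrow> others_min r i \<omega> < c"
  unfolding others_min_def by (rule order.strict_trans1[OF capped_min_le[of _ j]]) auto

lemma other_seller:
  obtains j where "j < N" "j \<noteq> i"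
  using others_nonempty[of i] by blast

lemma event_two_less: "i < N \<Longrightarrow> j < N \<Longrightarrow> {\<omega> \<in> space M. v i \<omega> < c \<and> v j \<omega> < c} \<in> sets M"
  by measurable

text \<open>The strict ex ante comparisons below all draw their strictness from this non-null
  event.\<close>

lemma emeasure_two_less:
  assumes "i < N" "j < N" "i \<noteq> j" "0 < c" "c \<le> 1"
  shows "emeasure M {\<omega> \<in> space M. v i \<omega> < c \<and> v j \<omega> < c} \<noteq> 0"
  using prob_two_less[OF assms(1-3), of c] F_pos[of c] assms by (simp add: emeasure_eq_measure)

lemma expectation_acceptance:
  assumes "i < N" "0 \<le> c" "c \<le> r"
  shows "integrable M (\<lambda>\<omega>. max c (others_min r i \<omega>))"
    and "expectation (\<lambda>\<omega>. max c (others_min r i \<omega>)) = acceptance_price r c"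
  using integrable_others_min[of r i] expectation_max_others_min[of i c r] assms
  by (auto simp: acceptance_price_def)

context
  fixes r c :: real
  assumes c: "0 < c" "c \<le> r" and r: "r \<le> 1"
begin

lemma r_nonneg: "0 \<le> r" using c by simp

text \<open>For \<open>x < c\<close> the payoff with the speculator is the mean of
  \<open>max c (?m \<omega>) - x\<close>, which dominates the payoff without him pointwise. For
  larger \<open>x\<close> the payoffs agree.\<close>

lemma seller_interim:
  assumes i: "i < N"
  shows seller_interim_le:
    "expectation (\<lambda>\<omega>. seller_payoff0 N r ((\<lambda>j. v j \<omega>)(i := x)) i)
      \<le> expectation (\<lambda>\<omega>. seller_payoff1 N r (acceptance_price r c) c ((\<lambda>j. v j \<omega>)(i := x)) i)"
      (is "?E0 \<le> ?E1")
    and seller_interim_less: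
    "x < c \<Longrightarrow> expectation (\<lambda>\<omega>. seller_payoff0 N r ((\<lambda>j. v j \<omega>)(i := x)) i)
      < expectation (\<lambda>\<omega>. seller_payoff1 N r (acceptance_price r c) c ((\<lambda>j. v j \<omega>)(i := x)) i)"
proof -
  let ?m = "others_min r i"
  note m = integrable_others_min[OF r_nonneg, of i]
  note max = expectation_acceptance[OF i less_imp_le[OF c(1)] c(2)]
  show less: "?E0 < ?E1" if x: "x < c"
  proof -
    obtain j where j: "j < N" "j \<noteq> i" by (rule other_seller)
    have "expectation (\<lambda>\<omega>. max 0 (?m \<omega> - x)) < expectation (\<lambda>\<omega>. max c (?m \<omega>) - x)"
    proof (rule integral_less_AE[where A = "{\<omega> \<in> space M. v j \<omega> < c}"])
      show "emeasure M {\<omega> \<in> space M. v j \<omega> < c} \<noteq> 0"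
        using prob_v_less[OF j(1), of c] F_pos[of c] c r by (simp add: emeasure_eq_measure)
      \<comment> \<open>A competitor with value below \<open>c\<close> forces
        \<open>?m \<omega> < c\<close>, so the left side is below \<open>c - x\<close>.\<close>
      have "max 0 (?m \<omega> - x) \<noteq> max c (?m \<omega>) - x" if "v j \<omega> < c" for \<omega>
        using others_min_less[OF j that, of r] x by (simp add: max_def)
      then show "AE \<omega> in M. \<omega> \<in> {\<omega> \<in> space M. v j \<omega> < c} \<longrightarrow>
          max 0 (?m \<omega> - x) \<noteq> max c (?m \<omega>) - x"
        by (intro AE_I2) blast
    qed (use m max j x in auto)
    also have "\<dots> = acceptance_price r c - x"
      using max by (simp add: prob_space)
    finally show ?thesis
      using x i by (simp add: seller_payoff0_update seller_payoff1_eq[OF c i] prob_space)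
  qed
  show "?E0 \<le> ?E1"
    using less i by (cases "x < c") (auto simp: seller_payoff1_eq[OF c i])
qed

text \<open>The offer is first replaced by \<open>?gain\<close>, which has the same mean. The
  comparison then holds pointwise, strictly if the seller and some competitor have values below
  \<open>c\<close>.\<close>

lemma seller_ex_ante:
  assumes i: "i < N"
  shows "expectation (\<lambda>\<omega>. seller_payoff0 N r (\<lambda>j. v j \<omega>) i)
    < expectation (\<lambda>\<omega>. seller_payoff1 N r (acceptance_price r c) c (\<lambda>j. v j \<omega>) i)"
proof -
  let ?m = "others_min r i"
  let ?p = "acceptance_price r c"
  let ?pay0 = "\<lambda>\<omega>. max 0 (?m \<omega> - v i \<omega>)"
  let ?rest = "\<lambda>\<omega>. if v i \<omega> < c then - v i \<omega> else ?pay0 \<omega>"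
  let ?gain = "\<lambda>\<omega>. if v i \<omega> < c then max c (?m \<omega>) else 0"
  obtain j where j: "j < N" "j \<noteq> i" by (rule other_seller)
  have pay0: "integrable M ?pay0"
    using integrable_others_min[OF r_nonneg, of i] integrable_v[OF i] by auto
  have rest: "integrable M ?rest"
    using pay0 integrable_v[OF i] i by (intro integrable_If) auto
  note gain = accepted_others_min[OF i less_imp_le[OF c(1)] c(2)]
  have "expectation ?pay0 < expectation (\<lambda>\<omega>. ?gain \<omega> + ?rest \<omega>)"
  proof (rule integral_less_AE[where A = "{\<omega> \<in> space M. v i \<omega> < c \<and> v j \<omega> < c}"])
    show "emeasure M {\<omega> \<in> space M. v i \<omega> < c \<and> v j \<omega> < c} \<noteq> 0"
      using emeasure_two_less[of i j c] i j c r by auto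
    have "?pay0 \<omega> \<noteq> ?gain \<omega> + ?rest \<omega>" if "v i \<omega> < c" "v j \<omega> < c" for \<omega>
      using others_min_less[OF j that(2), of r] that by (simp add: max_def)
    then show "AE \<omega> in M. \<omega> \<in> {\<omega> \<in> space M. v i \<omega> < c \<and> v j \<omega> < c} \<longrightarrow> ?pay0 \<omega> \<noteq> ?gain \<omega> + ?rest \<omega>"
      by (intro AE_I2) blast
  qed (use pay0 rest gain i j in auto)
  \<comment> \<open>The random payment is exchanged for the constant offer via
    \<open>accepted_others_min\<close>.\<close>
  also have "\<dots> = expectation (\<lambda>\<omega>. if v i \<omega> < c then ?p else 0) + expectation ?rest"
    using gain rest i by (simp add: expectation_If_less mult.commute)
  also have "\<dots> = expectation (\<lambda>\<omega>. (if v i \<omega> < c then ?p else 0) + ?rest \<omega>)"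
    using rest integrable_If_less[OF i] by simp
  also have "\<dots> = expectation (\<lambda>\<omega>. seller_payoff1 N r ?p c (\<lambda>j. v j \<omega>) i)"
    using i by (intro Bochner_Integration.integral_cong)
      (auto simp: seller_payoff1_eq[OF c i] seller_payoff0_others_min)
  finally show ?thesis using i by (simp add: seller_payoff0_others_min)
qed

lemma pred_sale [measurable]: "Measurable.pred M (\<lambda>\<omega>. \<exists>i<N. v i \<omega> \<le> r)"
proof -
  have "Measurable.pred M (\<lambda>\<omega>. \<exists>i\<in>{..<N}. v i \<omega> \<le> r)" by measurable
  then show ?thesis by (simp add: Bex_def)
qed

lemma integrable_auctioneer_payoff0:
  "integrable M (\<lambda>\<omega>. auctioneer_payoff0 A N r (\<lambda>i. v i \<omega>))"
proof -
  have N0: "0 < N" using N by simp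
  have "integrable M (\<lambda>\<omega>. Max ((\<lambda>i. others_min r i \<omega>) ` {..<N}))"
  proof (rule integrable_const_bound[where B = r])
    have "0 \<le> Max ((\<lambda>i. others_min r i \<omega>) ` {..<N})" if "\<forall>i<N. 0 < v i \<omega> \<and> v i \<omega> \<le> 1" for \<omega>
    proof -
      have "0 \<le> others_min r 0 \<omega>"
        using that r_nonneg by (force simp: others_min_def capped_min_ge_iff)
      also have "\<dots> \<le> Max ((\<lambda>i. others_min r i \<omega>) ` {..<N})"
        using N0 by (intro Max_ge) auto
      finally show ?thesis .
    qed
    moreover have "Max ((\<lambda>i. others_min r i \<omega>) ` {..<N}) \<le> r" for \<omega>
      using N0 others_min_le by (subst Max_le_iff) auto
    ultimately show "AE \<omega> in M. norm (Max ((\<lambda>i. others_min r i \<omega>) ` {..<N})) \<le> r"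
      using AE_v by (auto elim!: eventually_mono)
  qed (intro borel_measurable_Max, auto)
  then show ?thesis
    unfolding auctioneer_payoff0_eq[OF N0] others_min_def by (intro integrable_If) auto
qed

text \<open>The weak inequality holds profile by profile; two accepters make it strict.\<close>

lemma auctioneer_ex_ante:
  "expectation (\<lambda>\<omega>. auctioneer_payoff1 A N r c (\<lambda>i. v i \<omega>))
    < expectation (\<lambda>\<omega>. auctioneer_payoff0 A N r (\<lambda>i. v i \<omega>))"
proof (rule integral_less_AE[where A = "{\<omega> \<in> space M. v 0 \<omega> < c \<and> v 1 \<omega> < c}"])
  show "integrable M (\<lambda>\<omega>. auctioneer_payoff1 A N r c (\<lambda>i. v i \<omega>))"
    unfolding auctioneer_payoff1_eq[OF c]
    using integrable_auctioneer_payoff0 integrable_rejecters[OF c] by (intro integrable_If) auto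
  show "emeasure M {\<omega> \<in> space M. v 0 \<omega> < c \<and> v 1 \<omega> < c} \<noteq> 0"
    using emeasure_two_less[of 0 1 c] N c r by auto
  have "auctioneer_payoff1 A N r c (\<lambda>i. v i \<omega>) \<noteq> auctioneer_payoff0 A N r (\<lambda>i. v i \<omega>)"
    if "v 0 \<omega> < c" "v 1 \<omega> < c" for \<omega>
    using auctioneer_payoff1_less[OF c, of 0 N 1 "\<lambda>i. v i \<omega>" A] that N by simp
  then show "AE \<omega> in M. \<omega> \<in> {\<omega> \<in> space M. v 0 \<omega> < c \<and> v 1 \<omega> < c} \<longrightarrow>
      auctioneer_payoff1 A N r c (\<lambda>i. v i \<omega>) \<noteq> auctioneer_payoff0 A N r (\<lambda>i. v i \<omega>)"
    by (intro AE_I2) blast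
  show "{\<omega> \<in> space M. v 0 \<omega> < c \<and> v 1 \<omega> < c} \<in> sets M"
    using N by (intro event_two_less) auto
qed (use integrable_auctioneer_payoff0 auctioneer_payoff1_le[OF c] in auto)

section \<open>Efficiency loss for a measurable choice \<open>s\<close> of the resold item\<close>

context
  fixes s :: "'w \<Rightarrow> nat"
  assumes s_measurable: "s \<in> measurable M (count_space UNIV)"
    and s_accepter: "\<And>\<omega>. \<omega> \<in> space M \<Longrightarrow> accepters N c (\<lambda>i. v i \<omega>) \<noteq> {} \<Longrightarrow>
      s \<omega> \<in> accepters N c (\<lambda>i. v i \<omega>)"
begin

text \<open>A fixed index set makes integrability a termwise matter although both accepters and
  \<open>s\<close> are random.\<close>

lemma destroyed_value_eq_sum:
  "destroyed_value N c k w = (\<Sum>i<N. if w i < c \<and> i \<noteq> k then w i else 0)"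
  unfolding destroyed_value_def
  by (rule sum.mono_neutral_cong_left) (auto simp: accepters_def)

lemma integrable_destroyed_value:
  "integrable M (\<lambda>\<omega>. destroyed_value N c (s \<omega>) (\<lambda>i. v i \<omega>))"
  unfolding destroyed_value_eq_sum
proof (rule Bochner_Integration.integrable_sum)
  fix i assume "i \<in> {..<N}"
  then have i: "i < N" by simp
  note [measurable] = s_measurable
  show "integrable M (\<lambda>\<omega>. if v i \<omega> < c \<and> i \<noteq> s \<omega> then v i \<omega> else 0)"
    using i integrable_v by (intro integrable_If) (auto intro: i)
qed

lemma AE_destroyed_value_nonneg: "AE \<omega> in M. 0 \<le> destroyed_value N c (s \<omega>) (\<lambda>i. v i \<omega>)"
  using AE_v
proof eventually_elim
  case (elim \<omega>)
  then show ?case unfolding destroyed_value_eq_sum by (intro sum_nonneg) auto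
qed

lemma AE_destroyed_value_pos:
  "AE \<omega> in M. v 0 \<omega> < c \<and> v 1 \<omega> < c \<longrightarrow> 0 < destroyed_value N c (s \<omega>) (\<lambda>i. v i \<omega>)"
  using AE_v
proof eventually_elim
  case (elim \<omega>)
  show ?case
  proof
    assume less: "v 0 \<omega> < c \<and> v 1 \<omega> < c"
    \<comment> \<open>At least one of sellers 0 and 1 is not the one whose item is resold; his
      positive value is lost.\<close>
    define i where "i = (if s \<omega> = 0 then 1 else 0 :: nat)"
    have "i < N" "i \<noteq> s \<omega>" "v i \<omega> < c" using N less by (auto simp: i_def)
    then show "0 < destroyed_value N c (s \<omega>) (\<lambda>i. v i \<omega>)"
      unfolding destroyed_value_eq_sum using elim by (intro sum_pos2[of _ i]) auto
  qed
qed

lemma expectation_destroyed_value_pos: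
  "0 < expectation (\<lambda>\<omega>. destroyed_value N c (s \<omega>) (\<lambda>i. v i \<omega>))"
proof -
  have "expectation (\<lambda>_. 0) < expectation (\<lambda>\<omega>. destroyed_value N c (s \<omega>) (\<lambda>i. v i \<omega>))"
  proof (rule integral_less_AE[where A = "{\<omega> \<in> space M. v 0 \<omega> < c \<and> v 1 \<omega> < c}"])
    show "emeasure M {\<omega> \<in> space M. v 0 \<omega> < c \<and> v 1 \<omega> < c} \<noteq> 0"
      using emeasure_two_less[of 0 1 c] N c r by auto
    show "AE \<omega> in M. \<omega> \<in> {\<omega> \<in> space M. v 0 \<omega> < c \<and> v 1 \<omega> < c} \<longrightarrow>
        0 \<noteq> destroyed_value N c (s \<omega>) (\<lambda>i. v i \<omega>)"
      using AE_destroyed_value_pos by (auto elim!: eventually_mono)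
    show "{\<omega> \<in> space M. v 0 \<omega> < c \<and> v 1 \<omega> < c} \<in> sets M"
    using N by (intro event_two_less) auto
  qed (use AE_destroyed_value_nonneg integrable_destroyed_value in auto)
  then show ?thesis by simp
qed

lemma integrable_surplus0: "integrable M (\<lambda>\<omega>. surplus0 A N r (\<lambda>i. v i \<omega>))"
  unfolding surplus0_def
  using integrable_auctioneer_payoff0 integrable_others_min[OF r_nonneg] integrable_v
  by (intro Bochner_Integration.integrable_add Bochner_Integration.integrable_sum)
    (auto simp: seller_payoff0_others_min)

lemma integrable_surplus1: "integrable M (\<lambda>\<omega>. surplus1 A N r p c (\<lambda>i. v i \<omega>))"
proof -
  have "integrable M (\<lambda>\<omega>. \<Sum>i\<in>accepters N c (\<lambda>i. v i \<omega>). v i \<omega>)"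
    unfolding sum_accepters using integrable_v
    by (intro Bochner_Integration.integrable_sum integrable_If) auto
  then show ?thesis
    unfolding surplus1_eq[OF c] using integrable_surplus0 by (intro integrable_If) auto
qed

text \<open>The misallocation term is nonnegative, so the mean loss is at least the positive mean of
  the destroyed value.\<close>

lemma surplus_less:
  "expectation (\<lambda>\<omega>. surplus1 A N r p c (\<lambda>i. v i \<omega>)) < expectation (\<lambda>\<omega>. surplus0 A N r (\<lambda>i. v i \<omega>))"
proof -
  have "destroyed_value N c (s \<omega>) (\<lambda>i. v i \<omega>)
      \<le> surplus0 A N r (\<lambda>i. v i \<omega>) - surplus1 A N r p c (\<lambda>i. v i \<omega>)" if "\<omega> \<in> space M" for \<omega>
  proof -
    have "0 \<le> misallocation N c (s \<omega>) (\<lambda>i. v i \<omega>)"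
      using s_accepter[OF that] by (simp add: misallocation_def)
    then show ?thesis
      using surplus_difference[OF c, where w = "\<lambda>i. v i \<omega>" and k = "s \<omega>" and N = N] s_accepter[OF that]
      by simp
  qed
  then have "expectation (\<lambda>\<omega>. destroyed_value N c (s \<omega>) (\<lambda>i. v i \<omega>))
      \<le> expectation (\<lambda>\<omega>. surplus0 A N r (\<lambda>i. v i \<omega>) - surplus1 A N r p c (\<lambda>i. v i \<omega>))"
    using integrable_destroyed_value integrable_surplus0 integrable_surplus1
    by (intro integral_mono) auto
  then show ?thesis
    using expectation_destroyed_value_pos integrable_surplus0 integrable_surplus1 by simp
qed

end

end

end

text \<open>Optimality of \<open>p\<close> supplies a cutoff in \<open>(0, r]\<close> whose
  acceptance price is \<open>p\<close>; the comparisons then hold at every such cutoff.\<close>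

theorem corollary1:
  fixes M :: "'w measure" and v :: "nat \<Rightarrow> 'w \<Rightarrow> real" and f F :: "real \<Rightarrow> real"
    and N :: nat and r p c A :: real and s :: "'w \<Rightarrow> nat"
  assumes "prob_space M"
    and "N \<ge> 2"
    and "prob_space.indep_vars M (\<lambda>_. borel) v {..<N}"
    and "\<And>x. 0 \<le> f x"
    and "\<And>i. i < N \<Longrightarrow> distributed M lborel (v i) (\<lambda>x. ennreal (f x))"
    and "F = cdf (density lborel (\<lambda>x. ennreal (f x)))"
    and "F 0 = 0" and "F 1 = 1" and "\<And>x. 0 < x \<Longrightarrow> x \<le> 1 \<Longrightarrow> 0 < F x"
    and "0 < r" and "r \<le> 1"
    and "optimal_offer M v F N r p"
    and "c = cutoff F N r p"
    and "s \<in> measurable M (count_space UNIV)"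
    and "\<And>\<omega>. \<omega> \<in> space M \<Longrightarrow> accepters N c (\<lambda>i. v i \<omega>) \<noteq> {} \<Longrightarrow>
           s \<omega> \<in> accepters N c (\<lambda>i. v i \<omega>)"
  shows
    "(\<integral>\<omega>. surplus1 A N r p c (\<lambda>i. v i \<omega>) \<partial>M) < (\<integral>\<omega>. surplus0 A N r (\<lambda>i. v i \<omega>) \<partial>M)
     \<and> 0 < (\<integral>\<omega>. destroyed_value N c (s \<omega>) (\<lambda>i. v i \<omega>) \<partial>M)
     \<and> (\<forall>\<omega>\<in>space M.
          surplus0 A N r (\<lambda>i. v i \<omega>) - surplus1 A N r p c (\<lambda>i. v i \<omega>)
            = destroyed_value N c (s \<omega>) (\<lambda>i. v i \<omega>) + misallocation N c (s \<omega>) (\<lambda>i. v i \<omega>))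
     \<and> (\<forall>i<N. (\<integral>\<omega>. seller_payoff0 N r (\<lambda>j. v j \<omega>) i \<partial>M)
                 < (\<integral>\<omega>. seller_payoff1 N r p c (\<lambda>j. v j \<omega>) i \<partial>M))
     \<and> (\<forall>i<N. \<forall>x\<in>{0..1}.
          (\<integral>\<omega>. seller_payoff0 N r ((\<lambda>j. v j \<omega>)(i := x)) i \<partial>M)
            \<le> (\<integral>\<omega>. seller_payoff1 N r p c ((\<lambda>j. v j \<omega>)(i := x)) i \<partial>M)
          \<and> (x < c \<longrightarrow>
              (\<integral>\<omega>. seller_payoff0 N r ((\<lambda>j. v j \<omega>)(i := x)) i \<partial>M)
                < (\<integral>\<omega>. seller_payoff1 N r p c ((\<lambda>j. v j \<omega>)(i := x)) i \<partial>M)))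
     \<and> (\<integral>\<omega>. auctioneer_payoff1 A N r c (\<lambda>i. v i \<omega>) \<partial>M)
           < (\<integral>\<omega>. auctioneer_payoff0 A N r (\<lambda>i. v i \<omega>) \<partial>M)"
proof -
  interpret iid_values M v f F N
    using assms(1-3,5-9) by (intro iid_values.intro iid_values_axioms.intro)
  have c: "0 < c" "c \<le> r" and p: "p = acceptance_price r c"
    using optimal_offer_cutoff[OF assms(10-12)] assms(13) by simp_all
  note s = assms(14,15)
  show ?thesis
    using surplus_less[OF c assms(11) s] expectation_destroyed_value_pos[OF c assms(11) s]
      surplus_difference[OF c s(2)] seller_ex_ante[OF c assms(11)] auctioneer_ex_ante[OF c assms(11)]
      seller_interim[OF c assms(11)]
    unfolding p by blast
qed

end
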